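(* Let $\mathbf{A}=(A,\mu,\alpha)$ be a system and let $\mathbf{F}=(F,\lambda,\varphi)$ be the trivial subsystem, i.e. $F=\mathbb{C}1$, $\lambda=\mu|_F$ and $\varphi=\alpha|_F$. Then $\mathbf{A}$ has discrete spectrum relative to $\mathbf{F}$ if and only if $\mathbf{A}$ has discrete spectrum, i.e. $H$ is the closed linear span of the eigenvectors of $U$.
   Context: Inner products are linear in the second variable. A system $\mathbf{A}=(A,\mu,\alpha)$ consists of a von Neumann algebra $A$, a faithful normal trace $\mu$ on $A$ (a positive linear functional on $A$, so $A$ is finite), and a $*$-automorphism $\alpha$ of $A$ with $\mu\circ\alpha=\mu$. $A$ is taken to act on a Hilbert space $H$ with a cyclic and separating vector $\Omega$ such that $\mu(a)=\langle\Omega,a\Omega\rangle$ for all $a\in A$. $U$ is the unitary on $H$ determined by $Ua\Omega=\alpha(a)\Omega$ for $a\in A$. A system $\mathbf{F}=(F,\lambda,\varphi)$ is a subsystem of $\mathbf{A}$ if $F$ is a von Neumann subalgebra of $A$ containing the unit of $A$, $\mu|_F=\lambda$ and $\alpha|_F=\varphi$. Put $H_F:=\overline{F\Omega}$ and let $e_F$ be the orthogonal projection of $H$ onto $H_F$. Let $J$ be the modular conjugation (the antiunitary extending $a\Omega\mapsto a^*\Omega$, $a\in A$) and $j(a):=Ja^*J$. The basic construction $\langle A,e_F\rangle$ is the von Neumann algebra on $H$ generated by $A$ and $e_F$; it carries the canonical faithful normal semifinite tracial weight $\bar\mu:\langle A,e_F\rangle^+\to[0,\infty]$ determined by $\bar\mu(ae_Fb)=\mu(ab)$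 for $a,b\in A$ (extended linearly to $\operatorname{span}\{ae_Fb:a,b\in A\}$). $H$ is a right $A$-module by $xa:=j(a)x$. A closed subspace $V\subset H$ is a right-$F$-submodule if $xa\in V$ for all $x\in V$, $a\in F$ (equivalently, its orthogonal projection $P_V$ lies in $\langle A,e_F\rangle$), and is $U$-invariant if $UV=V$. A $U$-$\bar\mu$-module is a $U$-invariant right-$F$-submodule $V\subset H\ominus H_F$ with $\bar\mu(P_V)<\infty$. $\mathcal{E}_{A/F}$ is the closed subspace of $H\ominus H_F$ spanned by all $U$-$\bar\mu$-modules. $\mathbf{A}$ has discrete spectrum relative to $\mathbf{F}$ if $\mathcal{E}_{A/F}=H\ominus H_F$. *)

theory Defs
  imports "HOL-Analysis.Analysis"
begin

text \<open>The topology, norm and completeness come from the library's real classes; the real inner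
  product is the real part of the complex one, which is linear in the second variable.\<close>

class complex_inner = real_inner +
  fixes scaleC :: "complex \<Rightarrow> 'a \<Rightarrow> 'a" (infixr "*\<^sub>C" 75)
    and cinner :: "'a \<Rightarrow> 'a \<Rightarrow> complex"
  assumes scaleC_add_right: "c *\<^sub>C (x + y) = c *\<^sub>C x + c *\<^sub>C y"
    and scaleC_add_left: "(c + d) *\<^sub>C x = c *\<^sub>C x + d *\<^sub>C x"
    and scaleC_scaleC: "c *\<^sub>C d *\<^sub>C x = (c * d) *\<^sub>C x"
    and scaleR_scaleC: "r *\<^sub>R x = complex_of_real r *\<^sub>C x"
    and cinner_add_right: "cinner x (y + z) = cinner x y + cinner x z"
    and cinner_scaleC_right: "cinner x (c *\<^sub>C y) = c * cinner x y"
    and cinner_commute: "cinner x y = cnj (cinner y x)"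
    and inner_eq_Re_cinner: "inner x y = Re (cinner x y)"

class chilbert_space = complex_inner + complete_space

instantiation complex :: chilbert_space
begin

definition scaleC_complex :: "complex \<Rightarrow> complex \<Rightarrow> complex"
  where "scaleC_complex c x = c * x"

definition cinner_complex :: "complex \<Rightarrow> complex \<Rightarrow> complex"
  where "cinner_complex x y = cnj x * y"

instance
  by standard
    (simp_all add: scaleC_complex_def cinner_complex_def algebra_simps scaleR_conv_of_real
      inner_complex_def)

end

interpretation complex_vector: vector_space "scaleC :: complex \<Rightarrow> 'a \<Rightarrow> 'a::complex_inner"
proof
  fix x :: 'a
  have "1 *\<^sub>C x = 1 *\<^sub>R x" by (simp only: scaleR_scaleC of_real_1)
  then show "1 *\<^sub>C x = x" by simp
qed (simp_all add: scaleC_add_right scaleC_add_left scaleC_scaleC)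

abbreviation csubspace :: "'h::complex_inner set \<Rightarrow> bool"
  where "csubspace \<equiv> module.subspace scaleC"

abbreviation cspan :: "'h::complex_inner set \<Rightarrow> 'h set"
  where "cspan \<equiv> module.span scaleC"

definition ortho_complement :: "'h::complex_inner set \<Rightarrow> 'h set"
  where "ortho_complement V = {x. \<forall>v\<in>V. cinner v x = 0}"

definition ortho_proj :: "'h::complex_inner set \<Rightarrow> 'h \<Rightarrow> 'h"
  where "ortho_proj V x = (THE y. y \<in> V \<and> x - y \<in> ortho_complement V)"

definition bounded_clinear :: "('h::complex_inner \<Rightarrow> 'h) \<Rightarrow> bool"
  where "bounded_clinear T \<longleftrightarrow> bounded_linear T \<and> (\<forall>c x. T (c *\<^sub>C x) = c *\<^sub>C T x)"

definition cadjoint :: "('h::complex_inner \<Rightarrow> 'h) \<Rightarrow> 'h \<Rightarrow> 'h"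
  where "cadjoint T = (SOME S. \<forall>x y. cinner (S x) y = cinner x (T y))"

definition unitary_op :: "('h::complex_inner \<Rightarrow> 'h) \<Rightarrow> bool"
  where "unitary_op U \<longleftrightarrow> bounded_clinear U \<and> (\<forall>x y. cinner (U x) (U y) = cinner x y) \<and> surj U"

definition antiunitary_op :: "('h::complex_inner \<Rightarrow> 'h) \<Rightarrow> bool"
  where "antiunitary_op J \<longleftrightarrow>
    (\<forall>x y. J (x + y) = J x + J y) \<and> (\<forall>c x. J (c *\<^sub>C x) = cnj c *\<^sub>C J x) \<and>
    (\<forall>x y. cinner (J x) (J y) = cinner y x) \<and> surj J"

definition positive_op :: "('h::complex_inner \<Rightarrow> 'h) \<Rightarrow> bool"
  where "positive_op T \<longleftrightarrow> bounded_clinear T \<and> (\<forall>x. cinner x (T x) \<in> \<real>\<^sub>\<ge>\<^sub>0)"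

definition op_le :: "('h::complex_inner \<Rightarrow> 'h) \<Rightarrow> ('h \<Rightarrow> 'h) \<Rightarrow> bool"
  where "op_le S T \<longleftrightarrow> positive_op (\<lambda>x. T x - S x)"

definition commutant :: "('h::complex_inner \<Rightarrow> 'h) set \<Rightarrow> ('h \<Rightarrow> 'h) set"
  where "commutant M = {T. bounded_clinear T \<and> (\<forall>S\<in>M. T \<circ> S = S \<circ> T)}"

text \<open>In particular a von Neumann algebra contains the identity operator, which is its unit.\<close>

definition von_neumann_algebra :: "('h::complex_inner \<Rightarrow> 'h) set \<Rightarrow> bool"
  where "von_neumann_algebra M \<longleftrightarrow>
    (\<forall>a\<in>M. bounded_clinear a \<and> cadjoint a \<in> M) \<and> commutant (commutant M) = M"

definition positive_part :: "('h::complex_inner \<Rightarrow> 'h) set \<Rightarrow> ('h \<Rightarrow> 'h) set"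
  where "positive_part M = {a \<in> M. positive_op a}"

definition op_directed :: "('h::complex_inner \<Rightarrow> 'h) set \<Rightarrow> bool"
  where "op_directed D \<longleftrightarrow> D \<noteq> {} \<and> (\<forall>a\<in>D. \<forall>b\<in>D. \<exists>c\<in>D. op_le a c \<and> op_le b c)"

definition op_lub :: "('h::complex_inner \<Rightarrow> 'h) set \<Rightarrow> ('h \<Rightarrow> 'h) set \<Rightarrow> ('h \<Rightarrow> 'h) \<Rightarrow> bool"
  where "op_lub M D s \<longleftrightarrow> s \<in> positive_part M \<and> (\<forall>d\<in>D. op_le d s) \<and>
    (\<forall>t\<in>positive_part M. (\<forall>d\<in>D. op_le d t) \<longrightarrow> op_le s t)"

definition normal_on :: "('h::complex_inner \<Rightarrow> 'h) set \<Rightarrow> (('h \<Rightarrow> 'h) \<Rightarrow> ennreal) \<Rightarrow> bool"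
  where "normal_on M w \<longleftrightarrow>
    (\<forall>D s. D \<subseteq> positive_part M \<longrightarrow> op_directed D \<longrightarrow> op_lub M D s \<longrightarrow> w s = (SUP d\<in>D. w d))"

text \<open>Finite traces are not assumed to be normalized.\<close>

definition faithful_normal_trace ::
  "('h::complex_inner \<Rightarrow> 'h) set \<Rightarrow> (('h \<Rightarrow> 'h) \<Rightarrow> complex) \<Rightarrow> bool"
  where "faithful_normal_trace A \<mu> \<longleftrightarrow>
    (\<forall>a\<in>A. \<forall>b\<in>A. \<mu> (\<lambda>x. a x + b x) = \<mu> a + \<mu> b) \<and>
    (\<forall>c. \<forall>a\<in>A. \<mu> (\<lambda>x. c *\<^sub>C a x) = c * \<mu> a) \<and>
    (\<forall>a\<in>positive_part A. \<mu> a \<in> \<real>\<^sub>\<ge>\<^sub>0) \<and>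
    (\<forall>a\<in>A. \<forall>b\<in>A. \<mu> (a \<circ> b) = \<mu> (b \<circ> a)) \<and>
    (\<forall>a\<in>positive_part A. \<mu> a = 0 \<longrightarrow> a = (\<lambda>x. 0)) \<and>
    normal_on A (\<lambda>a. ennreal (Re (\<mu> a)))"

text \<open>Weights are total functions; only their values on the positive part of \<open>M\<close> matter.\<close>

definition fns_tracial_weight ::
  "('h::complex_inner \<Rightarrow> 'h) set \<Rightarrow> (('h \<Rightarrow> 'h) \<Rightarrow> ennreal) \<Rightarrow> bool"
  where "fns_tracial_weight M \<tau> \<longleftrightarrow>
    (\<forall>a\<in>positive_part M. \<forall>b\<in>positive_part M. \<tau> (\<lambda>x. a x + b x) = \<tau> a + \<tau> b) \<and>
    (\<forall>r\<ge>0. \<forall>a\<in>positive_part M. \<tau> (\<lambda>x. r *\<^sub>R a x) = ennreal r * \<tau> a) \<and>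
    (\<forall>a\<in>M. \<tau> (cadjoint a \<circ> a) = \<tau> (a \<circ> cadjoint a)) \<and>
    (\<forall>a\<in>positive_part M. \<tau> a = 0 \<longrightarrow> a = (\<lambda>x. 0)) \<and>
    normal_on M \<tau> \<and>
    (\<forall>a\<in>positive_part M. a \<noteq> (\<lambda>x. 0) \<longrightarrow>
      (\<exists>b\<in>positive_part M. b \<noteq> (\<lambda>x. 0) \<and> op_le b a \<and> \<tau> b < \<infinity>))"

definition star_automorphism ::
  "('h::complex_inner \<Rightarrow> 'h) set \<Rightarrow> (('h \<Rightarrow> 'h) \<Rightarrow> 'h \<Rightarrow> 'h) \<Rightarrow> bool"
  where "star_automorphism A \<alpha> \<longleftrightarrow> bij_betw \<alpha> A A \<and>
    (\<forall>a\<in>A. \<forall>b\<in>A. \<alpha> (\<lambda>x. a x + b x) = (\<lambda>x. \<alpha> a x + \<alpha> b x)) \<and>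
    (\<forall>c. \<forall>a\<in>A. \<alpha> (\<lambda>x. c *\<^sub>C a x) = (\<lambda>x. c *\<^sub>C \<alpha> a x)) \<and>
    (\<forall>a\<in>A. \<forall>b\<in>A. \<alpha> (a \<circ> b) = \<alpha> a \<circ> \<alpha> b) \<and>
    (\<forall>a\<in>A. \<alpha> (cadjoint a) = cadjoint (\<alpha> a))"

record 'h system_data =
  alg :: "('h \<Rightarrow> 'h) set"
  tr :: "('h \<Rightarrow> 'h) \<Rightarrow> complex"
  aut :: "('h \<Rightarrow> 'h) \<Rightarrow> 'h \<Rightarrow> 'h"

definition system :: "'h::chilbert_space system_data \<Rightarrow> bool"
  where "system A \<longleftrightarrow> von_neumann_algebra (alg A) \<and> faithful_normal_trace (alg A) (tr A) \<and>
    star_automorphism (alg A) (aut A) \<and> (\<forall>a\<in>alg A. tr A (aut A a) = tr A a)"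

definition represented_by :: "'h::chilbert_space system_data \<Rightarrow> 'h \<Rightarrow> bool"
  where "represented_by A \<Omega> \<longleftrightarrow>
    closure ((\<lambda>a. a \<Omega>) ` alg A) = UNIV \<and>
    (\<forall>a\<in>alg A. a \<Omega> = 0 \<longrightarrow> a = (\<lambda>x. 0)) \<and>
    (\<forall>a\<in>alg A. tr A a = cinner \<Omega> (a \<Omega>))"

definition subsystem :: "'h::chilbert_space system_data \<Rightarrow> 'h system_data \<Rightarrow> bool"
  where "subsystem F A \<longleftrightarrow> system F \<and> alg F \<subseteq> alg A \<and>
    (\<forall>a\<in>alg F. tr A a = tr F a) \<and> (\<forall>a\<in>alg F. aut A a = aut F a)"

definition scalar_ops :: "('h::complex_inner \<Rightarrow> 'h) set"
  where "scalar_ops = range (\<lambda>c x. c *\<^sub>C x)"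

definition evolution :: "'h::chilbert_space system_data \<Rightarrow> 'h \<Rightarrow> 'h \<Rightarrow> 'h"
  where "evolution A \<Omega> = (THE U. unitary_op U \<and> (\<forall>a\<in>alg A. U (a \<Omega>) = aut A a \<Omega>))"

definition modular_conj :: "'h::chilbert_space system_data \<Rightarrow> 'h \<Rightarrow> 'h \<Rightarrow> 'h"
  where "modular_conj A \<Omega> =
    (THE J. antiunitary_op J \<and> (\<forall>a\<in>alg A. J (a \<Omega>) = cadjoint a \<Omega>))"

definition right_action :: "'h::chilbert_space system_data \<Rightarrow> 'h \<Rightarrow> 'h \<Rightarrow> ('h \<Rightarrow> 'h) \<Rightarrow> 'h"
  where "right_action A \<Omega> x a = modular_conj A \<Omega> (cadjoint a (modular_conj A \<Omega> x))"

definition sub_space :: "'h::chilbert_space \<Rightarrow> 'h system_data \<Rightarrow> 'h set"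
  where "sub_space \<Omega> F = closure ((\<lambda>a. a \<Omega>) ` alg F)"

definition sub_proj :: "'h::chilbert_space \<Rightarrow> 'h system_data \<Rightarrow> 'h \<Rightarrow> 'h"
  where "sub_proj \<Omega> F = ortho_proj (sub_space \<Omega> F)"

definition basic_construction ::
  "'h::chilbert_space system_data \<Rightarrow> 'h \<Rightarrow> 'h system_data \<Rightarrow> ('h \<Rightarrow> 'h) set"
  where "basic_construction A \<Omega> F = von_neumann_algebra hull (insert (sub_proj \<Omega> F) (alg A))"

text \<open>The last condition says that the linear extension of \<open>\<tau>\<close> maps \<open>a e\<^sub>F b\<close> to \<open>\<mu> (a b)\<close>,
  spelled out on the positive elements of the linear span of these operators; by polarization
  these span everything.\<close>

definition canonical_weight ::
  "'h::chilbert_space system_data \<Rightarrow> 'h \<Rightarrow> 'h system_data \<Rightarrow> (('h \<Rightarrow> 'h) \<Rightarrow> ennreal) \<Rightarrow> bool"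
  where "canonical_weight A \<Omega> F \<tau> \<longleftrightarrow> fns_tracial_weight (basic_construction A \<Omega> F) \<tau> \<and>
    (\<forall>(n::nat) a b. (\<forall>i<n. a i \<in> alg A \<and> b i \<in> alg A) \<longrightarrow>
      (let t = (\<lambda>x. \<Sum>i<n. a i (sub_proj \<Omega> F (b i x)))
       in positive_op t \<longrightarrow>
          \<tau> t < \<infinity> \<and> complex_of_real (enn2real (\<tau> t)) = (\<Sum>i<n. tr A (a i \<circ> b i))))"

definition right_submodule ::
  "'h::chilbert_space system_data \<Rightarrow> 'h \<Rightarrow> 'h system_data \<Rightarrow> 'h set \<Rightarrow> bool"
  where "right_submodule A \<Omega> F V \<longleftrightarrow> csubspace V \<and> closed V \<and>
    (\<forall>x\<in>V. \<forall>a\<in>alg F. right_action A \<Omega> x a \<in> V)"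

definition U_weight_module ::
  "'h::chilbert_space system_data \<Rightarrow> 'h \<Rightarrow> 'h system_data \<Rightarrow> (('h \<Rightarrow> 'h) \<Rightarrow> ennreal) \<Rightarrow>
    'h set \<Rightarrow> bool"
  where "U_weight_module A \<Omega> F \<tau> V \<longleftrightarrow> right_submodule A \<Omega> F V \<and>
    evolution A \<Omega> ` V = V \<and> V \<subseteq> ortho_complement (sub_space \<Omega> F) \<and> \<tau> (ortho_proj V) < \<infinity>"

definition module_span ::
  "'h::chilbert_space system_data \<Rightarrow> 'h \<Rightarrow> 'h system_data \<Rightarrow> (('h \<Rightarrow> 'h) \<Rightarrow> ennreal) \<Rightarrow> 'h set"
  where "module_span A \<Omega> F \<tau> = closure (cspan (\<Union>{V. U_weight_module A \<Omega> F \<tau> V}))"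

definition rel_discrete_spectrum ::
  "'h::chilbert_space system_data \<Rightarrow> 'h \<Rightarrow> 'h system_data \<Rightarrow> (('h \<Rightarrow> 'h) \<Rightarrow> ennreal) \<Rightarrow> bool"
  where "rel_discrete_spectrum A \<Omega> F \<tau> \<longleftrightarrow>
    module_span A \<Omega> F \<tau> = ortho_complement (sub_space \<Omega> F)"

definition discrete_spectrum :: "'h::chilbert_space system_data \<Rightarrow> 'h \<Rightarrow> bool"
  where "discrete_spectrum A \<Omega> \<longleftrightarrow>
    closure (cspan {x. x \<noteq> 0 \<and> (\<exists>c. evolution A \<Omega> x = c *\<^sub>C x)}) = UNIV"

end

theory Submission
  imports Defs "HOL-Computational_Algebra.Fundamental_Theorem_Algebra"
begin

text \<open>For \<open>F = \<complex>1\<close> the basic construction is the algebra of all bounded operators, because an operator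
  commuting with \<open>A\<close> and with the projection \<open>e\<^sub>F\<close> onto \<open>\<complex>\<Omega>\<close> is scalar.  The trace property gives all rank-one
  projections the same weight, namely that of \<open>e\<^sub>F\<close>, which is finite and nonzero; so the submodules
  of finite weight are exactly the finite-dimensional subspaces.  On such a subspace a unitary is
  diagonalizable, and conversely an eigenvector of \<open>U\<close> orthogonal to \<open>\<Omega>\<close> spans a one-dimensional
  module.  Since \<open>U\<Omega> = \<Omega>\<close>, passing between \<open>H\<close> and \<open>H \<ominus> \<complex>\<Omega>\<close> does not affect the discreteness of the spectrum.\<close>

section \<open>Complex inner product spaces\<close>

text \<open>The operators \<open>ortho_proj\<close>, \<open>cadjoint\<close>,
  \<open>evolution\<close> and \<open>modular_conj\<close> are introduced by description or choice,
  so the projection theorem, the Riesz representation and the extension of isometries from a dense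
  set must come before anything can be said about them. The size of the basic construction matters
  because the trace property compares the weights of two rank-one projections only when the partial
  isometry between them belongs to that algebra. If \<open>k\<close> is the common weight of the
  rank-one projections, then \<open>n\<close> orthonormal vectors in \<open>V\<close> force
  \<open>n * k \<le> \<tau> (ortho_proj V)\<close>; this is how a finite weight bounds the
  dimension. An eigenvector need not be orthogonal to \<Omega>, but invariance of \<Omega> shows
  that one with eigenvalue other than 1 is, and for eigenvalue 1 the component along \<Omega> can be
  subtracted.\<close>

lemma cinner_add_left: "cinner (x + y) z = cinner x z + cinner y z"
  by (metis cinner_add_right cinner_commute complex_cnj_add)

lemma cinner_scaleC_left: "cinner (c *\<^sub>C x) y = cnj c * cinner x y"
  by (metis cinner_scaleC_right cinner_commute complex_cnj_mult)

lemma cinner_self: "cinner x x = complex_of_real ((norm x)\<^sup>2)"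
proof -
  have "cinner x x = cnj (cinner x x)" by (rule cinner_commute)
  then have "Im (cinner x x) = 0" by (simp add: complex_eq_iff)
  then show ?thesis
    by (simp add: complex_eq_iff power2_norm_eq_inner inner_eq_Re_cinner)
qed

lemma cinner_self_eq_0 [simp]: "cinner x x = 0 \<longleftrightarrow> x = 0"
  by (simp add: cinner_self)

lemma norm_scaleC: "norm (c *\<^sub>C x) = cmod c * norm x"
proof -
  have "cinner (c *\<^sub>C x) (c *\<^sub>C x) = (c * cnj c) * cinner x x"
    by (simp add: cinner_scaleC_left cinner_scaleC_right)
  then have "complex_of_real ((norm (c *\<^sub>C x))\<^sup>2) = complex_of_real ((cmod c * norm x)\<^sup>2)"
    by (simp add: cinner_self complex_norm_square [symmetric] power_mult_distrib del: of_real_power)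
  then show ?thesis
    by (simp add: power2_eq_iff_nonneg del: of_real_power)
qed

text \<open>The factor \<i> sits in the conjugate-linear slot, so it contributes -\<i>. The identity
  reduces complex statements, such as boundedness of \<open>cinner\<close> and orthogonality to a
  complex subspace, to the real inner product.\<close>

lemma Im_cinner: "Im (cinner x y) = inner (\<i> *\<^sub>C x) y"
  by (simp add: inner_eq_Re_cinner cinner_scaleC_left)

interpretation cinner: bounded_bilinear "cinner :: 'a::complex_inner \<Rightarrow> 'a \<Rightarrow> complex"
proof
  fix x y :: 'a and r :: real
  show "cinner (r *\<^sub>R x) y = r *\<^sub>R cinner x y" "cinner x (r *\<^sub>R y) = r *\<^sub>R cinner x y"
    by (simp_all add: scaleR_scaleC [of r x] scaleR_scaleC [of r y] cinner_scaleC_left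
          cinner_scaleC_right scaleR_conv_of_real [where 'a = complex])
  show "\<exists>K. \<forall>x y :: 'a. norm (cinner x y) \<le> norm x * norm y * K"
  proof (intro exI allI)
    fix x y :: 'a
    \<comment> \<open>Cauchy-Schwarz for the real inner product is applied to the real and the
      imaginary part separately, whence the constant 2.\<close>
    have "cmod (cinner x y) \<le> \<bar>inner x y\<bar> + \<bar>inner (\<i> *\<^sub>C x) y\<bar>"
      using cmod_le [of "cinner x y"] by (simp add: inner_eq_Re_cinner [of x] Im_cinner)
    also have "\<dots> \<le> norm x * norm y + norm (\<i> *\<^sub>C x) * norm y"
      by (intro add_mono Cauchy_Schwarz_ineq2)
    finally show "cmod (cinner x y) \<le> norm x * norm y * 2"
      by (simp add: norm_scaleC)
  qed
qed (simp_all add: cinner_add_left cinner_add_right)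

interpretation scaleC: bounded_bilinear "scaleC :: complex \<Rightarrow> 'a::complex_inner \<Rightarrow> 'a"
proof
  show "\<exists>K. \<forall>c (x::'a). norm (c *\<^sub>C x) \<le> norm c * norm x * K"
    by (rule exI [of _ 1]) (simp add: norm_scaleC)
qed (simp_all add: scaleC_add_right scaleC_add_left scaleC_scaleC scaleR_scaleC [where 'a = 'a]
      scaleR_conv_of_real [where 'a = complex] mult.commute)

lemma cinner_ext: "(\<And>z. cinner z x = cinner z y) \<Longrightarrow> x = y"
  by (metis cinner.diff_right cinner_self_eq_0 right_minus_eq)

lemma cinner_eq_0_commute: "cinner x y = 0 \<longleftrightarrow> cinner y x = 0"
  by (metis cinner_commute complex_cnj_zero)

section \<open>Closed subspaces and orthogonal complements\<close>

lemma csubspace_closure: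
  assumes "csubspace (S :: 'h::complex_inner set)"
  shows "csubspace (closure S)"
proof (rule complex_vector.subspaceI)
  show "0 \<in> closure S"
    using complex_vector.subspace_0 [OF assms] closure_subset by blast
  show "x + y \<in> closure S" if "x \<in> closure S" "y \<in> closure S" for x y
  proof -
    obtain a b where "\<And>n. a n \<in> S" "a \<longlonglongrightarrow> x" "\<And>n. b n \<in> S" "b \<longlonglongrightarrow> y"
      using \<open>x \<in> closure S\<close> \<open>y \<in> closure S\<close> unfolding closure_sequential by blast
    then show ?thesis
      using complex_vector.subspace_add [OF assms] tendsto_add
      unfolding closure_sequential by (metis (no_types, lifting))
  qed
  show "c *\<^sub>C x \<in> closure S" if "x \<in> closure S" for c x
  proof -
    obtain a where "\<And>n. a n \<in> S" "a \<longlonglongrightarrow> x"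
      using \<open>x \<in> closure S\<close> unfolding closure_sequential by blast
    then show ?thesis
      using complex_vector.subspace_scale [OF assms] scaleC.tendsto [OF tendsto_const]
      unfolding closure_sequential by (metis (no_types, lifting))
  qed
qed

lemma closure_cspan_superset: "S \<subseteq> closure (cspan S)"
  using complex_vector.span_superset closure_subset by (rule order_trans)

lemma closure_cspan_minimal:
  assumes "S \<subseteq> V" "csubspace V" "closed V"
  shows "closure (cspan S) \<subseteq> V"
  using assms by (intro closure_minimal complex_vector.span_minimal)

lemma csubspace_ortho_complement [simp]: "csubspace (ortho_complement S)"
  by (rule complex_vector.subspaceI)
    (simp_all add: ortho_complement_def cinner_add_right cinner_scaleC_right cinner.zero_right)

lemma closed_ortho_complement [simp]: "closed (ortho_complement S)"
proof -
  have "ortho_complement S = (\<Inter>v\<in>S. {x. cinner v x = 0})"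
    by (auto simp: ortho_complement_def)
  then show ?thesis
    by (auto intro!: closed_INT closed_Collect_eq continuous_intros cinner.continuous_on)
qed

section \<open>Orthogonal projections and adjoints\<close>

text \<open>The foot of the perpendicular is the limit of a sequence in \<open>V\<close> minimizing
  the distance to \<open>x\<close>; the parallelogram law makes the sequence Cauchy, and minimality
  makes the difference orthogonal to \<open>V\<close>.\<close>

lemma ortho_proj_ex:
  fixes V :: "'h::chilbert_space set"
  assumes V: "csubspace V" "closed V"
  shows "\<exists>y\<in>V. x - y \<in> ortho_complement V"
proof -
  define d where "d = infdist x V"
  have "V \<noteq> {}" using complex_vector.subspace_0 [OF V(1)] by auto
  have d_le: "d\<^sup>2 \<le> (norm (x - v))\<^sup>2" if "v \<in> V" for v
    using infdist_le [OF that, of x] infdist_nonneg [of x V]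
    by (simp add: d_def dist_norm power_mono)
  have scaleR_V: "r *\<^sub>R v \<in> V" if "v \<in> V" for r v
    using that V(1) by (simp add: scaleR_scaleC complex_vector.subspace_scale)
  have "\<exists>v\<in>V. (norm (x - v))\<^sup>2 < d\<^sup>2 + inverse (real (Suc n))" for n
  proof (rule ccontr)
    assume *: "\<not> ?thesis"
    have "sqrt (d\<^sup>2 + inverse (real (Suc n))) \<le> d"
      unfolding d_def infdist_notempty [OF \<open>V \<noteq> {}\<close>]
    proof (rule cINF_greatest [OF \<open>V \<noteq> {}\<close>])
      fix v assume "v \<in> V"
      with * show "sqrt ((INF a\<in>V. dist x a)\<^sup>2 + inverse (real (Suc n))) \<le> dist x v"
        by (auto simp: dist_norm not_less d_def infdist_notempty [OF \<open>V \<noteq> {}\<close>]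
            intro!: real_le_lsqrt)
    qed
    then have "d\<^sup>2 + inverse (real (Suc n)) \<le> d\<^sup>2"
      using sqrt_le_D by blast
    then show False by (simp add: field_simps)
  qed
  then obtain v where v: "\<And>n. v n \<in> V" "\<And>n. (norm (x - v n))\<^sup>2 < d\<^sup>2 + inverse (real (Suc n))"
    by metis
  have close: "(dist (v m) (v n))\<^sup>2 \<le> 2 * inverse (real (Suc m)) + 2 * inverse (real (Suc n))" for m n
  proof -
    \<comment> \<open>The midpoint of \<open>v m\<close> and \<open>v n\<close> lies in
      \<open>V\<close>, hence at distance at least \<open>d\<close> from \<open>x\<close>; the
      parallelogram law then bounds the distance of \<open>v m\<close> from
      \<open>v n\<close>.\<close>
    let ?a = "x - v m" and ?b = "x - v n"
    have "(1/2) *\<^sub>R (v m + v n) \<in> V"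
      by (intro scaleR_V complex_vector.subspace_add [OF V(1)] v)
    then have "d\<^sup>2 \<le> (norm ((1/2) *\<^sub>R (?a + ?b)))\<^sup>2"
      using d_le [of "(1/2) *\<^sub>R (v m + v n)"] by (simp add: algebra_simps scaleR_2 [symmetric] flip: scaleR_add_left)
    then have "4 * d\<^sup>2 \<le> (norm (?a + ?b))\<^sup>2"
      by (simp add: power_mult_distrib power_divide)
    moreover have "(norm (?a + ?b))\<^sup>2 + (dist (v m) (v n))\<^sup>2 = 2 * (norm ?a)\<^sup>2 + 2 * (norm ?b)\<^sup>2"
      by (simp add: dist_norm power2_norm_eq_inner inner_diff inner_add inner_commute)
    ultimately show ?thesis using v(2) [of m] v(2) [of n] by linarith
  qed
  have "Cauchy v"
  proof (rule metric_CauchyI)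
    fix e :: real assume "e > 0"
    then obtain N where N: "inverse (real (Suc N)) < e\<^sup>2 / 4"
      using reals_Archimedean [of "e\<^sup>2 / 4"] by auto
    show "\<exists>M. \<forall>m\<ge>M. \<forall>n\<ge>M. dist (v m) (v n) < e"
    proof (intro exI allI impI)
      fix m n assume "N \<le> m" "N \<le> n"
      then have "inverse (real (Suc m)) \<le> inverse (real (Suc N))"
        "inverse (real (Suc n)) \<le> inverse (real (Suc N))"
        by (auto intro!: le_imp_inverse_le)
      with close [of m n] N have "(dist (v m) (v n))\<^sup>2 < e\<^sup>2" by linarith
      then show "dist (v m) (v n) < e" using \<open>e > 0\<close> by (simp add: power_less_imp_less_base)
    qed
  qed
  then obtain y where y: "v \<longlonglongrightarrow> y" using Cauchy_convergent_iff convergent_def by blast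
  have "y \<in> V" using closed_sequentially [OF V(2)] v(1) y by blast
  define w where "w = x - y"
  have "(norm w)\<^sup>2 \<le> d\<^sup>2 + 0"
    unfolding w_def
  proof (rule LIMSEQ_le)
    show "(\<lambda>n. (norm (x - v n))\<^sup>2) \<longlonglongrightarrow> (norm (x - y))\<^sup>2" by (intro tendsto_intros y)
    show "(\<lambda>n. d\<^sup>2 + inverse (real (Suc n))) \<longlonglongrightarrow> d\<^sup>2 + 0"
      by (intro tendsto_intros LIMSEQ_inverse_real_of_nat)
    show "\<exists>N. \<forall>n\<ge>N. (norm (x - v n))\<^sup>2 \<le> d\<^sup>2 + inverse (real (Suc n))"
      using v(2) less_imp_le by blast
  qed
  have inner_0: "inner u w = 0" if "u \<in> V" for u
  proof (cases "u = 0")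
    case False
    \<comment> \<open>This \<open>t\<close> minimizes the norm of \<open>w - t *\<^sub>R u\<close>;
      unless \<open>u\<close> and \<open>w\<close> are orthogonal, the result would beat the
      distance \<open>d\<close>.\<close>
    define t where "t = inner u w / (norm u)\<^sup>2"
    have "y + t *\<^sub>R u \<in> V"
      using \<open>y \<in> V\<close> that V(1) by (intro complex_vector.subspace_add scaleR_V)
    then have "d\<^sup>2 \<le> (norm (x - (y + t *\<^sub>R u)))\<^sup>2" by (rule d_le)
    also have "x - (y + t *\<^sub>R u) = w - t *\<^sub>R u" by (simp add: w_def)
    finally have "(norm w)\<^sup>2 \<le> (norm (w - t *\<^sub>R u))\<^sup>2"
      using \<open>(norm w)\<^sup>2 \<le> d\<^sup>2 + 0\<close> by linarith
    also have "\<dots> = (norm w)\<^sup>2 - 2 * t * inner u w + t\<^sup>2 * (norm u)\<^sup>2"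
      unfolding power2_norm_eq_inner
      by (simp add: inner_diff inner_commute power2_eq_square algebra_simps)
    also have "\<dots> = (norm w)\<^sup>2 - (inner u w)\<^sup>2 / (norm u)\<^sup>2"
      using False by (simp add: t_def power2_eq_square field_simps)
    finally show ?thesis using False by (simp add: divide_le_0_iff)
  qed simp
  \<comment> \<open>Real orthogonality to \<open>u\<close> kills the real part, and to
    \<open>\<i> *\<^sub>C u\<close> the imaginary part.\<close>
  have "cinner u w = 0" if "u \<in> V" for u
    using inner_0 [OF that] inner_0 [OF complex_vector.subspace_scale [OF V(1) that, of \<i>]]
    by (simp add: complex_eq_iff inner_eq_Re_cinner [of u] Im_cinner)
  then show ?thesis using \<open>y \<in> V\<close> by (auto simp: ortho_complement_def w_def)
qed

lemma ortho_proj_eqI: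
  fixes V :: "'h::complex_inner set"
  assumes V: "csubspace V" and y: "y \<in> V" "x - y \<in> ortho_complement V"
  shows "ortho_proj V x = y"
  unfolding ortho_proj_def
proof (rule the_equality)
  fix z assume z: "z \<in> V \<and> x - z \<in> ortho_complement V"
  have "y - z \<in> V" using V y z by (simp add: complex_vector.subspace_diff)
  moreover have "y - z \<in> ortho_complement V"
    using complex_vector.subspace_diff [OF csubspace_ortho_complement, of "x - z" V "x - y"] y z by simp
  ultimately have "cinner (y - z) (y - z) = 0" by (auto simp: ortho_complement_def)
  then show "z = y" by simp
qed (use y in simp)

lemma
  fixes V :: "'h::chilbert_space set"
  assumes V: "csubspace V" "closed V"
  shows ortho_proj_in: "ortho_proj V x \<in> V"
    and ortho_proj_diff: "x - ortho_proj V x \<in> ortho_complement V"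
proof -
  obtain y where "y \<in> V" "x - y \<in> ortho_complement V" using ortho_proj_ex [OF V] by blast
  then show "ortho_proj V x \<in> V" "x - ortho_proj V x \<in> ortho_complement V"
    using ortho_proj_eqI [OF V(1)] by auto
qed

lemma cinner_ortho_proj:
  fixes V :: "'h::chilbert_space set"
  assumes "csubspace V" "closed V" "v \<in> V"
  shows "cinner v (ortho_proj V x) = cinner v x"
  using ortho_proj_diff [OF assms(1,2), of x] assms(3)
  by (simp add: ortho_complement_def cinner.diff_right)

section \<open>Bounded complex-linear operators, the Riesz representation and adjoints\<close>

lemma bounded_clinearI:
  assumes "\<And>x y. T (x + y) = T x + T y" "\<And>c x. T (c *\<^sub>C x) = c *\<^sub>C T x"
    and "\<And>x. norm (T x) \<le> norm x * K"
  shows "bounded_clinear T"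
  unfolding bounded_clinear_def
  using assms by (auto intro!: bounded_linear_intro simp: scaleR_scaleC)

lemma bounded_clinear_add: "bounded_clinear T \<Longrightarrow> T (x + y) = T x + T y"
  and bounded_clinear_scaleC: "bounded_clinear T \<Longrightarrow> T (c *\<^sub>C x) = c *\<^sub>C T x"
  and bounded_clinear_zero: "bounded_clinear T \<Longrightarrow> T 0 = 0"
  by (auto simp: bounded_clinear_def linear_simps)

lemma bounded_clinear_continuous: "bounded_clinear T \<Longrightarrow> continuous_on S T"
  by (simp add: bounded_clinear_def linear_continuous_on)

lemma bounded_clinear_comp: "bounded_clinear S \<Longrightarrow> bounded_clinear T \<Longrightarrow> bounded_clinear (S \<circ> T)"
  by (auto simp: bounded_clinear_def o_def bounded_linear_compose)

lemma bounded_clinear_scaled: "bounded_clinear (\<lambda>x. c *\<^sub>C x)"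
  by (rule bounded_clinearI [where K = "cmod c"])
    (simp_all add: scaleC_add_right scaleC_scaleC norm_scaleC mult.commute)

lemma bounded_clinear_plus:
  "bounded_clinear S \<Longrightarrow> bounded_clinear T \<Longrightarrow> bounded_clinear (\<lambda>x. S x + T x)"
  by (auto simp: bounded_clinear_def bounded_linear_add scaleC_add_right)

lemma bounded_clinear_minus:
  "bounded_clinear S \<Longrightarrow> bounded_clinear T \<Longrightarrow> bounded_clinear (\<lambda>x. S x - T x)"
  by (auto simp: bounded_clinear_def bounded_linear_sub scaleC.diff_right)

lemma bounded_clinear_rank_one: "bounded_clinear (\<lambda>x. cinner y x *\<^sub>C z)"
proof -
  have "bounded_linear (\<lambda>x. cinner y x *\<^sub>C z)"
    by (rule bounded_linear_compose [OF scaleC.bounded_linear_left cinner.bounded_linear_right])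
  then show ?thesis
    by (simp add: bounded_clinear_def cinner_scaleC_right scaleC_scaleC)
qed

lemma bounded_clinear_ortho_proj:
  fixes V :: "'h::chilbert_space set"
  assumes V: "csubspace V" "closed V"
  shows "bounded_clinear (ortho_proj V)"
proof (rule bounded_clinearI)
  note [simp] = ortho_proj_in [OF V] ortho_proj_diff [OF V]
  show "ortho_proj V (x + y) = ortho_proj V x + ortho_proj V y" for x y
    using complex_vector.subspace_add [OF csubspace_ortho_complement,
        of "x - ortho_proj V x" V "y - ortho_proj V y"]
    by (intro ortho_proj_eqI V complex_vector.subspace_add) (simp_all add: algebra_simps)
  show "ortho_proj V (c *\<^sub>C x) = c *\<^sub>C ortho_proj V x" for c x
    using complex_vector.subspace_scale [OF csubspace_ortho_complement,
        of "x - ortho_proj V x" V c]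
    by (intro ortho_proj_eqI V complex_vector.subspace_scale) (simp_all add: scaleC.diff_right)
  show "norm (ortho_proj V x) \<le> norm x * 1" for x
  proof -
    have "cinner (ortho_proj V x) (x - ortho_proj V x) = 0"
      using ortho_proj_in [OF V, of x] ortho_proj_diff [OF V, of x]
      unfolding ortho_complement_def by blast
    then have "inner (ortho_proj V x) (x - ortho_proj V x) = 0"
      by (simp add: inner_eq_Re_cinner)
    then have "(norm x)\<^sup>2 = (norm (ortho_proj V x))\<^sup>2 + (norm (x - ortho_proj V x))\<^sup>2"
      by (simp add: power2_norm_eq_inner inner_diff inner_commute)
    then have "(norm (ortho_proj V x))\<^sup>2 \<le> (norm x)\<^sup>2" by simp
    then show ?thesis by (simp add: power2_le_iff_abs_le)
  qed
qed

text \<open>The kernel of a nonzero functional is a closed subspace of codimension one, so the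
  functional is determined by a vector \<open>w\<close> orthogonal to the kernel, up to
  normalization.\<close>

lemma riesz_representation:
  fixes f :: "'h::chilbert_space \<Rightarrow> complex"
  assumes f: "bounded_linear f" and scale: "\<And>c x. f (c *\<^sub>C x) = c * f x"
  shows "\<exists>y. \<forall>x. f x = cinner y x"
proof (cases "\<forall>x. f x = 0")
  case True
  then show ?thesis by (intro exI [of _ 0]) (simp add: cinner.zero_left)
next
  case False
  then obtain x0 where x0: "f x0 \<noteq> 0" by blast
  define V where "V = {x. f x = 0}"
  have V: "csubspace V" "closed V"
  proof -
    show "csubspace V"
      by (rule complex_vector.subspaceI) (auto simp: V_def linear_simps [OF f] scale)
    show "closed V"
      unfolding V_def by (intro closed_Collect_eq linear_continuous_on f continuous_on_const)
  qed
  define w where "w = x0 - ortho_proj V x0"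
  have "f (ortho_proj V x0) = 0" using ortho_proj_in [OF V] by (simp add: V_def)
  then have fw: "f w \<noteq> 0" using x0 by (simp add: w_def linear_simps [OF f])
  then have "w \<noteq> 0" by (auto simp: linear_simps [OF f])
  have w: "cinner v w = 0" if "f v = 0" for v
    using ortho_proj_diff [OF V, of x0] that by (simp add: ortho_complement_def w_def V_def)
  have "f x = cinner ((cnj (f w) / (norm w)\<^sup>2) *\<^sub>C w) x" for x
  proof -
    \<comment> \<open>The combination is chosen to lie in the kernel, to which \<open>w\<close> is
      orthogonal.\<close>
    have "f (f w *\<^sub>C x - f x *\<^sub>C w) = 0" by (simp add: linear_simps [OF f] scale)
    then have "cinner w (f w *\<^sub>C x - f x *\<^sub>C w) = 0" using w cinner_eq_0_commute by blast
    then have "f w * cinner w x = f x * complex_of_real ((norm w)\<^sup>2)"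
      by (simp add: cinner.diff_right cinner_scaleC_right cinner_self)
    then show ?thesis using \<open>w \<noteq> 0\<close> by (simp add: cinner_scaleC_left field_simps)
  qed
  then show ?thesis by blast
qed

text \<open>Since \<open>cadjoint\<close> is a choice among candidate adjoints, a candidate has to
  be exhibited; Riesz provides its value at each \<open>x\<close>.\<close>

lemma cinner_cadjoint:
  fixes T :: "'h::chilbert_space \<Rightarrow> 'h"
  assumes T: "bounded_clinear T"
  shows "cinner (cadjoint T x) y = cinner x (T y)"
proof -
  have "\<exists>z. \<forall>y. cinner x (T y) = cinner z y" for x
    using T by (intro riesz_representation)
      (auto simp: bounded_clinear_def cinner_scaleC_right
        intro: bounded_linear_compose [OF cinner.bounded_linear_right])
  then obtain S where "\<forall>x y. cinner (S x) y = cinner x (T y)" by metis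
  then have "\<forall>x y. cinner (cadjoint T x) y = cinner x (T y)"
    unfolding cadjoint_def by (rule someI [where P = "\<lambda>S. \<forall>x y. cinner (S x) y = cinner x (T y)"])
  then show ?thesis by blast
qed

lemma cadjoint_eqI:
  assumes "\<And>x y. cinner (S x) y = cinner x (T y)"
  shows "cadjoint T = S"
  unfolding cadjoint_def
proof (rule some_equality)
  fix S' assume S': "\<forall>x y. cinner (S' x) y = cinner x (T y)"
  have "S' x = S x" for x
    by (rule cinner_ext) (metis S' assms cinner_commute)
  then show "S' = S" by blast
qed (use assms in blast)

lemma cadjoint_cadjoint:
  fixes T :: "'h::chilbert_space \<Rightarrow> 'h"
  assumes "bounded_clinear T"
  shows "cadjoint (cadjoint T) = T"
  by (rule cadjoint_eqI) (metis assms cinner_cadjoint cinner_commute)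

section \<open>Extending isometries from a dense set\<close>

text \<open>The two cases \<open>\<sigma> = id\<close> and \<open>\<sigma> = cnj\<close> treat unitary and antiunitary operators together.\<close>

definition semiunitary :: "(complex \<Rightarrow> complex) \<Rightarrow> ('h::complex_inner \<Rightarrow> 'h) \<Rightarrow> bool"
  where "semiunitary \<sigma> T \<longleftrightarrow>
    (\<forall>x y. T (x + y) = T x + T y) \<and> (\<forall>c x. T (c *\<^sub>C x) = \<sigma> c *\<^sub>C T x) \<and>
    (\<forall>x y. cinner (T x) (T y) = \<sigma> (cinner x y)) \<and> surj T"

lemma norm_preserving_if_cinner:
  assumes "\<sigma> = id \<or> \<sigma> = cnj" "\<And>x. cinner (T x) (T x) = \<sigma> (cinner x x)"
  shows "norm (T x) = norm x"
proof -
  have "Re (cinner (T x) (T x)) = Re (cinner x x)" using assms by auto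
  then show ?thesis by (simp add: norm_eq_sqrt_inner inner_eq_Re_cinner)
qed

lemma semilinear_isometry_bounded_linear:
  assumes "\<sigma> = id \<or> \<sigma> = cnj" "\<And>x y. T (x + y) = T x + T y" "\<And>c x. T (c *\<^sub>C x) = \<sigma> c *\<^sub>C T x"
    and "\<And>x. norm (T x) = norm x"
  shows "bounded_linear T"
  using assms by (intro bounded_linear_intro [where K = 1]) (auto simp: scaleR_scaleC)

lemma semiunitary_bounded_linear:
  assumes "\<sigma> = id \<or> \<sigma> = cnj" "semiunitary \<sigma> T"
  shows "bounded_linear T"
  using assms norm_preserving_if_cinner [of \<sigma> T]
  by (intro semilinear_isometry_bounded_linear [of \<sigma>]) (auto simp: semiunitary_def)

lemma unitary_op_iff_semiunitary: "unitary_op T \<longleftrightarrow> semiunitary id T"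
  using semiunitary_bounded_linear [of id T]
  by (auto simp: unitary_op_def semiunitary_def bounded_clinear_def linear_simps)

lemma antiunitary_op_iff_semiunitary: "antiunitary_op T \<longleftrightarrow> semiunitary cnj T"
  unfolding antiunitary_op_def semiunitary_def using cinner_commute by metis

lemma isometric_extension:
  fixes f :: "'h::chilbert_space \<Rightarrow> 'h"
  assumes D: "closure D = UNIV" "closure (f ` D) = UNIV" and \<sigma>: "\<sigma> = id \<or> \<sigma> = cnj"
    and f: "\<And>x y. x \<in> D \<Longrightarrow> y \<in> D \<Longrightarrow> cinner (f x) (f y) = \<sigma> (cinner x y)"
  obtains g where "semiunitary \<sigma> g" "\<And>x. x \<in> D \<Longrightarrow> g x = f x"
proof -
  have Re_\<sigma>: "Re (\<sigma> z) = Re z" for z using \<sigma> by auto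
  have "dist (f x) (f y) = dist x y" if "x \<in> D" "y \<in> D" for x y
  proof -
    have "(dist (f x) (f y))\<^sup>2 = (dist x y)\<^sup>2"
      using that
      by (simp add: dist_norm power2_norm_eq_inner inner_diff) (simp add: inner_eq_Re_cinner f Re_\<sigma>)
    then show ?thesis by simp
  qed
  then have "uniformly_continuous_on D f" by (simp add: uniformly_continuous_on_def) blast
  then obtain g where g: "uniformly_continuous_on (closure D) g" "\<And>x. x \<in> D \<Longrightarrow> f x = g x"
    using uniformly_continuous_on_extension_on_closure by metis
  have cont: "continuous_on UNIV g" using g(1) D(1) by (simp add: uniformly_continuous_imp_continuous)
  have cont_\<sigma>: "continuous_on UNIV (\<lambda>x. \<sigma> (h x))" if "continuous_on UNIV h" for h :: "'h \<Rightarrow> complex"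
    using \<sigma> that by (auto intro!: continuous_intros)
  \<comment> \<open>Continuity removes the restriction to \<open>D\<close> in the second argument
    first, then in the other one.\<close>
  have 1: "cinner (g x) (g y) = \<sigma> (cinner x y)" if "x \<in> D" for x y
  proof -
    have "closed {y. cinner (g x) (g y) = \<sigma> (cinner x y)}"
      by (intro closed_Collect_eq cont_\<sigma> cinner.continuous_on continuous_intros cont)
    then have "closure D \<subseteq> {y. cinner (g x) (g y) = \<sigma> (cinner x y)}"
      using f g(2) that by (intro closure_minimal) force+
    then show ?thesis using D(1) by blast
  qed
  have inner_g: "cinner (g x) (g y) = \<sigma> (cinner x y)" for x y
  proof -
    have "closed {x. cinner (g x) (g y) = \<sigma> (cinner x y)}"
      by (intro closed_Collect_eq cont_\<sigma> cinner.continuous_on continuous_intros cont)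
    then have "closure D \<subseteq> {x. cinner (g x) (g y) = \<sigma> (cinner x y)}"
      using 1 by (intro closure_minimal) auto
    then show ?thesis using D(1) by blast
  qed
  have add: "g (x + y) = g x + g y" for x y
  proof -
    define w where "w = g (x + y) - g x - g y"
    have "cinner (g z) w = 0" for z
      using \<sigma> by (auto simp: w_def cinner.diff_right inner_g cinner_add_right)
    \<comment> \<open>The left \<open>w\<close> expands into a combination of values of
      \<open>g\<close>, all of which are orthogonal to \<open>w\<close>.\<close>
    then have "cinner w w = 0"
      by (subst w_def) (simp add: cinner.diff_left)
    then show ?thesis by (simp add: w_def algebra_simps)
  qed
  have scale: "g (c *\<^sub>C x) = \<sigma> c *\<^sub>C g x" for c x
  proof -
    define w where "w = g (c *\<^sub>C x) - \<sigma> c *\<^sub>C g x"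
    have "cinner (g z) w = 0" for z
      using \<sigma> by (auto simp: w_def cinner.diff_right inner_g cinner_scaleC_right)
    then have "cinner w w = 0"
      by (subst w_def) (simp add: cinner.diff_left cinner_scaleC_left)
    then show ?thesis by (simp add: w_def algebra_simps)
  qed
  have norm_g: "norm (g x) = norm x" for x
    using norm_preserving_if_cinner [OF \<sigma>, of g] inner_g by blast
  have "bounded_linear g"
    using semilinear_isometry_bounded_linear [OF \<sigma>] add scale norm_g by blast
  then have "complete (range g)"
    using complete_isometric_image [of 1 UNIV g]
    by (simp add: norm_g complete_UNIV)
  then have "closure (range g) = range g"
    using complete_imp_closed closure_closed by blast
  moreover have "closure (f ` D) \<subseteq> closure (range g)"
    using g(2) by (intro closure_mono) auto
  ultimately have "surj g" using D(2) by auto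
  then show thesis using that [of g] g(2) inner_g add scale by (auto simp: semiunitary_def)
qed

section \<open>Eigenvectors of unitaries on finite-dimensional invariant subspaces\<close>

definition op_poly :: "('h::complex_inner \<Rightarrow> 'h) \<Rightarrow> complex poly \<Rightarrow> 'h \<Rightarrow> 'h"
  where "op_poly T p x = (\<Sum>i\<le>degree p. coeff p i *\<^sub>C (T ^^ i) x)"

lemma op_poly_sum:
  assumes "degree p \<le> N"
  shows "op_poly T p x = (\<Sum>i\<le>N. coeff p i *\<^sub>C (T ^^ i) x)"
  unfolding op_poly_def
  by (rule sum.mono_neutral_left) (use assms in \<open>auto simp: coeff_eq_0 scaleC.zero_left not_le\<close>)

text \<open>Multiplying a polynomial by the variable shifts its coefficients, which amounts to one
  more application of \<open>T\<close>.\<close>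

lemma op_poly_linear_factor:
  assumes T: "bounded_clinear T"
  shows "op_poly T ([:- c, 1:] * q) x = T (op_poly T q x) - c *\<^sub>C op_poly T q x"
proof -
  let ?N = "Suc (degree q)"
  interpret T: bounded_linear T using T by (simp add: bounded_clinear_def)
  have factor: "[:- c, 1:] * q = pCons 0 q - smult c q" by simp
  have "degree (pCons 0 q - smult c q) \<le> ?N"
    by (rule degree_diff_le) (use degree_pCons_le [of 0 q] in auto)
  then have "op_poly T ([:- c, 1:] * q) x = (\<Sum>i\<le>?N. coeff (pCons 0 q - smult c q) i *\<^sub>C (T ^^ i) x)"
    unfolding factor by (rule op_poly_sum)
  also have "\<dots> = (\<Sum>i\<le>?N. coeff (pCons 0 q) i *\<^sub>C (T ^^ i) x) - c *\<^sub>C (\<Sum>i\<le>?N. coeff q i *\<^sub>C (T ^^ i) x)"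
    by (simp only: coeff_diff coeff_smult scaleC.diff_left sum_subtractf scaleC.sum_right scaleC_scaleC)
  also have "(\<Sum>i\<le>?N. coeff (pCons 0 q) i *\<^sub>C (T ^^ i) x) = T (op_poly T q x)"
    by (simp only: sum.atMost_Suc_shift)
      (simp add: scaleC.zero_left op_poly_def T.sum bounded_clinear_scaleC [OF T])
  also have "(\<Sum>i\<le>?N. coeff q i *\<^sub>C (T ^^ i) x) = op_poly T q x"
    by (rule op_poly_sum [symmetric]) simp
  finally show ?thesis .
qed

text \<open>A linear relation among the iterates of \<open>x\<close> is a polynomial in
  \<open>T\<close> killing \<open>x\<close>. Without one, the iterates would form an infinite
  independent set inside the span of the finite set \<open>B\<close>.\<close>

lemma annihilating_poly_ex:
  fixes T :: "'h::complex_inner \<Rightarrow> 'h"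
  assumes "finite B" and B: "\<And>i. (T ^^ i) x \<in> cspan B"
  shows "\<exists>p. p \<noteq> 0 \<and> op_poly T p x = 0"
proof (rule ccontr)
  assume no: "\<not> ?thesis"
  have indep: "u i = 0" if "finite I" "i \<in> I" "(\<Sum>i\<in>I. u i *\<^sub>C (T ^^ i) x) = 0" for I u i
  proof -
    define p where "p = (\<Sum>i\<in>I. monom (u i) i)"
    have coeff: "coeff p k = (if k \<in> I then u k else 0)" for k
      using \<open>finite I\<close> by (simp add: p_def coeff_sum)
    define N where "N = max (degree p) (Max I)"
    have "op_poly T p x = (\<Sum>i\<le>N. coeff p i *\<^sub>C (T ^^ i) x)" by (rule op_poly_sum) (simp add: N_def)
    also have "\<dots> = (\<Sum>i\<in>I. coeff p i *\<^sub>C (T ^^ i) x)"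
      using \<open>finite I\<close> Max_ge [OF \<open>finite I\<close>]
      by (intro sum.mono_neutral_right) (auto simp: N_def coeff scaleC.zero_left max.coboundedI2)
    finally have "op_poly T p x = 0" using that by (simp add: coeff)
    with no have "p = 0" by blast
    then show ?thesis using coeff [of i] that by simp
  qed
  \<comment> \<open>Independence of a set does not see repetitions, so distinctness is proved
    separately: a coincidence of two iterates is the relation with coefficients 1 and -1.\<close>
  have inj: "inj (\<lambda>i. (T ^^ i) x)"
  proof (rule injI, rule ccontr)
    fix i j assume "(T ^^ i) x = (T ^^ j) x" "i \<noteq> j"
    then show False
      using indep [of "{i, j}" i "\<lambda>k. if k = i then 1 else - 1"]
      by (simp add: scaleC.minus_left)
  qed
  have "\<not> module.dependent scaleC (range (\<lambda>i. (T ^^ i) x))"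
    unfolding complex_vector.dependent_explicit
  proof
    assume "\<exists>t u. finite t \<and> t \<subseteq> range (\<lambda>i. (T ^^ i) x) \<and>
      (\<Sum>v\<in>t. u v *\<^sub>C v) = 0 \<and> (\<exists>v\<in>t. u v \<noteq> 0)"
    then obtain t u i where t: "finite t" "t \<subseteq> range (\<lambda>i. (T ^^ i) x)" "(\<Sum>v\<in>t. u v *\<^sub>C v) = 0"
      "(T ^^ i) x \<in> t" and "u ((T ^^ i) x) \<noteq> 0"
      by blast
    define I where "I = (\<lambda>i. (T ^^ i) x) -` t"
    have "finite I" unfolding I_def using t(1) inj by (rule finite_vimageI)
    have "t = (\<lambda>i. (T ^^ i) x) ` I" using t(2) by (auto simp: I_def)
    then have "(\<Sum>i\<in>I. u ((T ^^ i) x) *\<^sub>C (T ^^ i) x) = 0"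
      using t(3) inj by (simp add: sum.reindex inj_on_subset)
    from indep [OF \<open>finite I\<close> _ this, of i] t(4) \<open>u ((T ^^ i) x) \<noteq> 0\<close>
    show False by (simp add: I_def)
  qed
  then have "finite (range (\<lambda>i. (T ^^ i) x))"
    using complex_vector.independent_span_bound [OF \<open>finite B\<close>] B by blast
  with inj show False using finite_imageD by blast
qed

text \<open>Take an annihilating polynomial of \<open>x\<close> of least degree and split off a root
  \<open>c\<close>. The cofactor \<open>q\<close> has smaller degree, so
  \<open>op_poly T q x\<close> is nonzero, and it is the eigenvector.\<close>

lemma eigenvector_ex:
  fixes T :: "'h::complex_inner \<Rightarrow> 'h"
  assumes T: "bounded_clinear T" and W: "csubspace W" "T ` W \<subseteq> W"
    and B: "finite B" "W \<subseteq> cspan B" and x: "x \<in> W" "x \<noteq> 0"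
  shows "\<exists>y c. y \<in> W \<and> y \<noteq> 0 \<and> T y = c *\<^sub>C y"
proof -
  have iter: "(T ^^ i) x \<in> W" for i by (induction i) (use W(2) x(1) in auto)
  have op_poly_W: "op_poly T p x \<in> W" for p
    unfolding op_poly_def
    by (intro complex_vector.subspace_sum complex_vector.subspace_scale W iter)
  define P where "P = (\<lambda>p. p \<noteq> 0 \<and> op_poly T p x = 0)"
  have "\<exists>p. P p" using annihilating_poly_ex [OF B(1)] iter B(2) unfolding P_def by blast
  then obtain p where p: "P p" and min: "\<And>q. P q \<Longrightarrow> degree p \<le> degree q"
    using ex_has_least_nat [of P _ degree] by blast
  \<comment> \<open>A nonzero constant does not annihilate \<open>x\<close>, so there is a root to
    split off.\<close>
  have "degree p \<noteq> 0"
  proof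
    assume "degree p = 0"
    then obtain a where "p = [:a:]" by (rule degree_eq_zeroE)
    with p x(2) show False by (auto simp: P_def op_poly_def)
  qed
  then obtain c where "poly p c = 0"
    using fundamental_theorem_of_algebra [of p] by (auto simp: constant_degree)
  then obtain q where q: "p = [:- c, 1:] * q" by (auto simp: poly_eq_0_iff_dvd elim: dvdE)
  with p have "q \<noteq> 0" by (auto simp: P_def)
  then have "degree p = Suc (degree q)" by (simp add: q degree_mult_eq del: mult_pCons_left)
  with min [of q] \<open>q \<noteq> 0\<close> have "op_poly T q x \<noteq> 0" by (auto simp: P_def)
  moreover have "T (op_poly T q x) = c *\<^sub>C op_poly T q x"
    using p op_poly_linear_factor [OF T, of c q x] by (simp add: P_def q del: mult_pCons_left)
  ultimately show ?thesis using op_poly_W by blast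
qed

section \<open>Orthonormal sets, finite dimension and diagonalization\<close>

definition orthonormal :: "'h::complex_inner set \<Rightarrow> bool"
  where "orthonormal B \<longleftrightarrow> (\<forall>x\<in>B. \<forall>y\<in>B. cinner x y = (if x = y then 1 else 0))"

lemma cinner_fourier_diff:
  assumes "orthonormal B" "finite B" "b \<in> B"
  shows "cinner b (x - (\<Sum>b\<in>B. cinner b x *\<^sub>C b)) = 0"
proof -
  have "cinner b (\<Sum>b\<in>B. cinner b x *\<^sub>C b) = (\<Sum>b'\<in>B. if b = b' then cinner b x else 0)"
    using assms
    unfolding cinner.sum_right cinner_scaleC_right
    by (intro sum.cong) (auto simp: orthonormal_def)
  then show ?thesis using assms by (simp add: cinner.diff_right)
qed

text \<open>An orthonormal set of greatest size spans \<open>V\<close>: otherwise a vector minus its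
  Fourier sum, normalized, could be added.\<close>

lemma finite_dimensional_if_orthonormal_bounded:
  fixes V :: "'h::complex_inner set"
  assumes V: "csubspace V"
    and bound: "\<And>B. B \<subseteq> V \<Longrightarrow> finite B \<Longrightarrow> orthonormal B \<Longrightarrow> card B \<le> N"
  shows "\<exists>B. finite B \<and> V \<subseteq> cspan B"
proof -
  define P where "P = (\<lambda>B. B \<subseteq> V \<and> finite B \<and> orthonormal B)"
  have "P {}" by (simp add: P_def orthonormal_def)
  moreover have "\<forall>B. P B \<longrightarrow> card B < Suc N" using bound by (auto simp: P_def less_Suc_eq_le)
  ultimately obtain B where B: "P B" and max: "\<And>C. P C \<Longrightarrow> card C \<le> card B"
    using ex_has_greatest_nat [of P "{}" card "Suc N"] by blast
  have "x \<in> cspan B" if "x \<in> V" for x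
  proof -
    define s where "s = (\<Sum>b\<in>B. cinner b x *\<^sub>C b)"
    have s: "s \<in> cspan B"
      unfolding s_def
      by (intro complex_vector.span_sum complex_vector.span_scale complex_vector.span_base)
    have "s \<in> V"
      unfolding s_def using B
      by (intro complex_vector.subspace_sum complex_vector.subspace_scale V) (auto simp: P_def)
    have "x - s = 0"
    proof (rule ccontr)
      assume "x - s \<noteq> 0"
      define e where "e = complex_of_real (inverse (norm (x - s))) *\<^sub>C (x - s)"
      have "e \<in> V"
        using \<open>s \<in> V\<close> that V
        by (simp add: e_def complex_vector.subspace_scale complex_vector.subspace_diff)
      have "cinner e e = 1"
        using \<open>x - s \<noteq> 0\<close> by (simp add: cinner_self e_def norm_scaleC norm_inverse)
      have "cinner b e = 0" if "b \<in> B" for b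
        using cinner_fourier_diff [of B b x] B that
        by (simp add: P_def e_def s_def cinner_scaleC_right)
      moreover from this have "cinner e b = 0" if "b \<in> B" for b
        using cinner_eq_0_commute that by blast
      ultimately have "orthonormal (insert e B)" "e \<notin> B"
        using B \<open>cinner e e = 1\<close> by (auto simp: orthonormal_def P_def)
      then have "P (insert e B)" using B \<open>e \<in> V\<close> by (simp add: P_def)
      with max [of "insert e B"] \<open>e \<notin> B\<close> B show False by (simp add: P_def)
    qed
    then show ?thesis using s by simp
  qed
  then show ?thesis using B by (auto simp: P_def)
qed

text \<open>Together the two facts make the orthogonal complement of an eigenvector invariant under
  \<open>U\<close>; the second also shows that eigenvalues are nonzero.\<close>

lemma cinner_eigenvector_unitary:
  assumes U: "unitary_op U" and v: "v \<noteq> 0" "U v = c *\<^sub>C v"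
  shows "cnj c * cinner v (U x) = cinner v x" "cnj c * c = 1"
proof -
  have *: "cinner (U a) (U b) = cinner a b" for a b using U by (simp add: unitary_op_def)
  show "cnj c * cinner v (U x) = cinner v x"
    using * [of v x] by (simp add: v cinner_scaleC_left)
  show "cnj c * c = 1"
    using * [of v v] v by (simp add: cinner_scaleC_left cinner_scaleC_right mult.commute)
qed

text \<open>The part \<open>W\<close> of \<open>V\<close> orthogonal to all eigenvectors in
  \<open>V\<close> is invariant, so if it were nonzero it would contain an eigenvector, which would
  be orthogonal to itself.\<close>

lemma finite_dimensional_eigenvectors_dense:
  fixes U :: "'h::chilbert_space \<Rightarrow> 'h"
  assumes U: "unitary_op U" and V: "csubspace V" "closed V" "U ` V \<subseteq> V"
    and B: "finite B" "V \<subseteq> cspan B"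
  shows "V \<subseteq> closure (cspan {x. x \<noteq> 0 \<and> (\<exists>c. U x = c *\<^sub>C x)})"
proof
  fix x assume x: "x \<in> V"
  define S where "S = {x\<in>V. x \<noteq> 0 \<and> (\<exists>c. U x = c *\<^sub>C x)}"
  \<comment> \<open>The closure makes the projection theorem applicable without an argument that
    finite-dimensional subspaces are closed.\<close>
  define E where "E = closure (cspan S)"
  define W where "W = V \<inter> ortho_complement S"
  have E: "csubspace E" "closed E" by (simp_all add: E_def csubspace_closure)
  have "E \<subseteq> V" unfolding E_def by (rule closure_cspan_minimal) (use V in \<open>auto simp: S_def\<close>)
  have "S \<subseteq> E" unfolding E_def by (rule closure_cspan_superset)
  have "csubspace W" by (simp add: W_def V complex_vector.subspace_inter)
  have "U ` W \<subseteq> W"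
  proof
    fix y assume "y \<in> U ` W"
    then obtain w where w: "w \<in> W" "y = U w" by blast
    have "cinner v (U w) = 0" if "v \<in> S" for v
    proof -
      have "cinner v w = 0" using w that by (simp add: W_def ortho_complement_def)
      obtain c where v: "v \<noteq> 0" "U v = c *\<^sub>C v" using \<open>v \<in> S\<close> by (auto simp: S_def)
      have "c \<noteq> 0" using cinner_eigenvector_unitary(2) [OF U v] by auto
      then show ?thesis
        using cinner_eigenvector_unitary(1) [OF U v, of w] \<open>cinner v w = 0\<close> by simp
    qed
    then show "y \<in> W" using w V by (auto simp: W_def ortho_complement_def)
  qed
  have "w = 0" if "w \<in> W" for w
  proof (rule ccontr)
    assume "w \<noteq> 0"
    have *: "bounded_clinear U" "W \<subseteq> cspan B" using U B by (auto simp: unitary_op_def W_def)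
    then obtain y c where y: "y \<in> W" "y \<noteq> 0" "U y = c *\<^sub>C y"
      using eigenvector_ex [OF *(1) \<open>csubspace W\<close> \<open>U ` W \<subseteq> W\<close> B(1) *(2) \<open>w \<in> W\<close> \<open>w \<noteq> 0\<close>] by blast
    then have "y \<in> S" by (auto simp: S_def W_def)
    with y show False by (auto simp: W_def ortho_complement_def)
  qed
  moreover have "x - ortho_proj E x \<in> W"
    using ortho_proj_in [OF E, of x] ortho_proj_diff [OF E, of x] \<open>E \<subseteq> V\<close> \<open>S \<subseteq> E\<close> x V(1)
    by (auto simp: W_def ortho_complement_def intro!: complex_vector.subspace_diff)
  ultimately have "x = ortho_proj E x" by fastforce
  then have "x \<in> E" using ortho_proj_in [OF E, of x] by metis
  also have "E \<subseteq> closure (cspan {x. x \<noteq> 0 \<and> (\<exists>c. U x = c *\<^sub>C x)})"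
    unfolding E_def by (intro closure_mono complex_vector.span_mono) (auto simp: S_def)
  finally show "x \<in> closure (cspan {x. x \<noteq> 0 \<and> (\<exists>c. U x = c *\<^sub>C x)})" .
qed

section \<open>The unitary and the modular conjugation of a system\<close>

text \<open>A von Neumann algebra is only required to be closed under adjoints and to equal its
  bicommutant; products and linear combinations in it come from its being a commutant.\<close>

lemma commutant_comp:
  assumes "S \<in> commutant M" "T \<in> commutant M"
  shows "S \<circ> T \<in> commutant M"
  using assms by (auto simp: commutant_def bounded_clinear_comp comp_assoc) (metis comp_assoc)

lemma commutant_add_scaleC:
  assumes "S \<in> commutant M" "T \<in> commutant M" "\<And>R. R \<in> M \<Longrightarrow> bounded_clinear R"
  shows "(\<lambda>x. S x + c *\<^sub>C T x) \<in> commutant M"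
proof -
  have "bounded_clinear (\<lambda>x. S x + c *\<^sub>C T x)"
    using bounded_clinear_plus bounded_clinear_comp [OF bounded_clinear_scaled, of T c] assms(1,2)
    by (auto simp: commutant_def o_def)
  then show ?thesis
    using assms
    by (auto simp: commutant_def fun_eq_iff bounded_clinear_add bounded_clinear_scaleC)
qed

locale represented_system =
  fixes A :: "'h::chilbert_space system_data" and \<Omega> :: 'h
  assumes sys: "system A" and rep: "represented_by A \<Omega>"
begin

lemma alg_bicommutant: "commutant (commutant (alg A)) = alg A"
  using sys by (simp add: system_def von_neumann_algebra_def)

lemma alg_bounded_clinear: "a \<in> alg A \<Longrightarrow> bounded_clinear a"
  and alg_cadjoint: "a \<in> alg A \<Longrightarrow> cadjoint a \<in> alg A"
  using sys by (auto simp: system_def von_neumann_algebra_def)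

lemma alg_comp: "a \<in> alg A \<Longrightarrow> b \<in> alg A \<Longrightarrow> a \<circ> b \<in> alg A"
  using commutant_comp [of a "commutant (alg A)" b] by (simp add: alg_bicommutant)

lemma alg_id: "id \<in> alg A"
proof -
  have "id \<in> commutant (commutant (alg A))"
    using bounded_clinear_scaled [of 1, where 'a = 'h] by (auto simp: commutant_def id_def o_def)
  then show ?thesis by (simp add: alg_bicommutant)
qed

lemma alg_separating:
  assumes "a \<in> alg A" "b \<in> alg A" "a \<Omega> = b \<Omega>"
  shows "a = b"
proof -
  have "(\<lambda>x. a x + (- 1) *\<^sub>C b x) \<in> commutant (commutant (alg A))"
    using assms by (intro commutant_add_scaleC) (auto simp: alg_bicommutant alg_bounded_clinear commutant_def)
  then have "(\<lambda>x. a x + (- 1) *\<^sub>C b x) = (\<lambda>x. 0)"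
    using rep assms(3) by (simp add: alg_bicommutant represented_by_def scaleC.minus_left)
  then show ?thesis by (auto simp: fun_eq_iff scaleC.minus_left)
qed

lemma alg_dense: "closure ((\<lambda>a. a \<Omega>) ` alg A) = UNIV"
  using rep by (simp add: represented_by_def)

text \<open>The space may be zero, in which case \<Omega> is zero too; a nonzero \<open>y\<close>
  excludes this case.\<close>

lemma Omega_nonzero: "(y :: 'h) \<noteq> 0 \<Longrightarrow> \<Omega> \<noteq> 0"
proof
  assume "y \<noteq> 0" "\<Omega> = 0"
  have "(\<lambda>a. a \<Omega>) ` alg A \<subseteq> {0}"
    using alg_bounded_clinear bounded_clinear_zero \<open>\<Omega> = 0\<close> by blast
  then have "closure ((\<lambda>a. a \<Omega>) ` alg A) \<subseteq> {0}" by (rule closure_minimal) simp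
  with alg_dense \<open>y \<noteq> 0\<close> show False by auto
qed

text \<open>The GNS identity: maps of the algebra that respect the trace become isometries on the
  dense set of vectors \<open>a \<Omega>\<close>.\<close>

lemma cinner_alg:
  assumes "a \<in> alg A" "b \<in> alg A"
  shows "cinner (a \<Omega>) (b \<Omega>) = tr A (cadjoint a \<circ> b)"
proof -
  have "tr A (cadjoint a \<circ> b) = cinner \<Omega> (cadjoint a (b \<Omega>))"
    using rep assms alg_comp alg_cadjoint by (simp add: represented_by_def)
  also have "\<dots> = cinner (a \<Omega>) (b \<Omega>)"
    using cinner_cadjoint [OF alg_bounded_clinear [OF assms(1)], of "b \<Omega>" \<Omega>]
    by (metis cinner_commute)
  finally show ?thesis by simp
qed

lemma trace_commute: "a \<in> alg A \<Longrightarrow> b \<in> alg A \<Longrightarrow> tr A (a \<circ> b) = tr A (b \<circ> a)"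
  using sys by (simp add: system_def faithful_normal_trace_def)

text \<open>This justifies the definite descriptions of \<open>evolution\<close> and
  \<open>modular_conj\<close>. The separating property makes the map on vectors
  \<open>a \<Omega>\<close> well defined, density gives the extension, and continuity its
  uniqueness.\<close>

lemma semiunitary_ex1:
  assumes \<sigma>: "\<sigma> = id \<or> \<sigma> = cnj" and g: "g ` alg A = alg A"
    and inner: "\<And>a b. a \<in> alg A \<Longrightarrow> b \<in> alg A \<Longrightarrow>
      cinner (g a \<Omega>) (g b \<Omega>) = \<sigma> (cinner (a \<Omega>) (b \<Omega>))"
  shows "\<exists>!T. semiunitary \<sigma> T \<and> (\<forall>a\<in>alg A. T (a \<Omega>) = g a \<Omega>)"
proof -
  let ?D = "(\<lambda>a. a \<Omega>) ` alg A"
  have inj: "inj_on (\<lambda>a. a \<Omega>) (alg A)" using alg_separating by (simp add: inj_on_def)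
  define f where "f = (\<lambda>x. g (inv_into (alg A) (\<lambda>a. a \<Omega>) x) \<Omega>)"
  have f: "f (a \<Omega>) = g a \<Omega>" if "a \<in> alg A" for a
    using inv_into_f_f [OF inj that] by (simp add: f_def)
  have "f ` ?D = (\<lambda>a. a \<Omega>) ` g ` alg A" using f by (auto simp: image_image)
  then have "closure (f ` ?D) = UNIV" using g alg_dense by simp
  moreover have "cinner (f x) (f y) = \<sigma> (cinner x y)" if "x \<in> ?D" "y \<in> ?D" for x y
    using that f inner by auto
  ultimately obtain T where T: "semiunitary \<sigma> T" "\<And>x. x \<in> ?D \<Longrightarrow> T x = f x"
    using isometric_extension [OF alg_dense _ \<sigma>] by metis
  show ?thesis
  proof (rule ex1I [of _ T])
    show "semiunitary \<sigma> T \<and> (\<forall>a\<in>alg A. T (a \<Omega>) = g a \<Omega>)" using T f by auto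
    fix S assume S: "semiunitary \<sigma> S \<and> (\<forall>a\<in>alg A. S (a \<Omega>) = g a \<Omega>)"
    have "closed {x. S x = T x}"
      using S T(1) semiunitary_bounded_linear [OF \<sigma>]
      by (intro closed_Collect_eq linear_continuous_on) auto
    then have "closure ?D \<subseteq> {x. S x = T x}" using S T f by (intro closure_minimal) auto
    with alg_dense show "S = T" by auto
  qed
qed

lemma
  shows evolution_unitary: "unitary_op (evolution A \<Omega>)"
    and evolution_alg: "a \<in> alg A \<Longrightarrow> evolution A \<Omega> (a \<Omega>) = aut A a \<Omega>"
proof -
  have aut: "star_automorphism (alg A) (aut A)" "\<forall>a\<in>alg A. tr A (aut A a) = tr A a"
    using sys by (auto simp: system_def)
  then have surj: "aut A ` alg A = alg A" by (simp add: star_automorphism_def bij_betw_def)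
  have "\<exists>!T. semiunitary id T \<and> (\<forall>a\<in>alg A. T (a \<Omega>) = aut A a \<Omega>)"
  proof (rule semiunitary_ex1 [OF _ surj])
    fix a b assume ab: "a \<in> alg A" "b \<in> alg A"
    then have "cinner (aut A a \<Omega>) (aut A b \<Omega>) = tr A (cadjoint (aut A a) \<circ> aut A b)"
      using surj by (intro cinner_alg) auto
    also have "cadjoint (aut A a) \<circ> aut A b = aut A (cadjoint a \<circ> b)"
      using aut(1) ab alg_cadjoint by (simp add: star_automorphism_def)
    also have "tr A \<dots> = cinner (a \<Omega>) (b \<Omega>)"
      using aut(2) ab alg_cadjoint alg_comp by (simp add: cinner_alg)
    finally show "cinner (aut A a \<Omega>) (aut A b \<Omega>) = id (cinner (a \<Omega>) (b \<Omega>))" by simp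
  qed simp
  from theI' [OF this] show "unitary_op (evolution A \<Omega>)"
    "a \<in> alg A \<Longrightarrow> evolution A \<Omega> (a \<Omega>) = aut A a \<Omega>"
    unfolding evolution_def unitary_op_iff_semiunitary by blast+
qed

text \<open>That the automorphism is unital is not among its axioms; it follows from
  multiplicativity, applied to the identity and a preimage of the identity.\<close>

lemma evolution_Omega: "evolution A \<Omega> \<Omega> = \<Omega>"
proof -
  have aut: "star_automorphism (alg A) (aut A)" using sys by (simp add: system_def)
  then have "id \<in> aut A ` alg A" using alg_id by (simp add: star_automorphism_def bij_betw_def)
  then obtain a where a: "a \<in> alg A" "aut A a = id" by force
  have "aut A (id \<circ> a) = aut A id \<circ> aut A a"
    using aut a(1) alg_id unfolding star_automorphism_def by blast
  then have "aut A id = id" using a by simp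
  then show ?thesis using evolution_alg [OF alg_id] by simp
qed

lemma
  shows modular_conj_antiunitary: "antiunitary_op (modular_conj A \<Omega>)"
    and modular_conj_alg: "a \<in> alg A \<Longrightarrow> modular_conj A \<Omega> (a \<Omega>) = cadjoint a \<Omega>"
proof -
  have cadjoint2: "cadjoint (cadjoint a) = a" if "a \<in> alg A" for a
    using that alg_bounded_clinear cadjoint_cadjoint by blast
  then have surj: "cadjoint ` alg A = alg A"
    using alg_cadjoint by (metis image_subsetI rev_image_eqI subsetI subset_antisym)
  have "\<exists>!T. semiunitary cnj T \<and> (\<forall>a\<in>alg A. T (a \<Omega>) = cadjoint a \<Omega>)"
  proof (rule semiunitary_ex1 [OF _ surj])
    fix a b assume ab: "a \<in> alg A" "b \<in> alg A"
    then have "cinner (cadjoint a \<Omega>) (cadjoint b \<Omega>) = tr A (a \<circ> cadjoint b)"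
      using alg_cadjoint cadjoint2 by (simp add: cinner_alg)
    \<comment> \<open>Commutativity under the trace is what makes taking adjoints isometric on
      vectors \<open>a \<Omega>\<close>.\<close>
    also have "\<dots> = tr A (cadjoint b \<circ> a)" using ab alg_cadjoint by (intro trace_commute)
    also have "\<dots> = cnj (cinner (a \<Omega>) (b \<Omega>))"
      using ab cinner_alg cinner_commute by metis
    finally show "cinner (cadjoint a \<Omega>) (cadjoint b \<Omega>) = cnj (cinner (a \<Omega>) (b \<Omega>))" .
  qed simp
  from theI' [OF this] show "antiunitary_op (modular_conj A \<Omega>)"
    "a \<in> alg A \<Longrightarrow> modular_conj A \<Omega> (a \<Omega>) = cadjoint a \<Omega>"
    unfolding modular_conj_def antiunitary_op_iff_semiunitary by blast+
qed

lemma modular_conj_involution: "modular_conj A \<Omega> (modular_conj A \<Omega> x) = x"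
proof -
  have J: "bounded_linear (modular_conj A \<Omega>)"
    using modular_conj_antiunitary semiunitary_bounded_linear [of cnj]
    by (simp add: antiunitary_op_iff_semiunitary)
  then have "closed {x. modular_conj A \<Omega> (modular_conj A \<Omega> x) = x}"
    by (intro closed_Collect_eq linear_continuous_on [OF bounded_linear_compose [OF J J]]
        continuous_on_id)
  then have "closure ((\<lambda>a. a \<Omega>) ` alg A) \<subseteq> {x. modular_conj A \<Omega> (modular_conj A \<Omega> x) = x}"
    by (intro closure_minimal)
      (auto simp: modular_conj_alg alg_cadjoint cadjoint_cadjoint alg_bounded_clinear simp del: o_apply)
  then show ?thesis using alg_dense by auto
qed

text \<open>The adjoint conjugates the scalar and the antilinear conjugation undoes this, so every
  complex subspace is stable under the right action of the scalars.\<close>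

lemma right_action_scalar: "right_action A \<Omega> x (\<lambda>z. c *\<^sub>C z) = c *\<^sub>C x"
proof -
  have "cadjoint (\<lambda>z::'h. c *\<^sub>C z) = (\<lambda>z. cnj c *\<^sub>C z)"
    by (rule cadjoint_eqI) (simp add: cinner_scaleC_left cinner_scaleC_right)
  then show ?thesis
    using modular_conj_antiunitary
    by (simp add: right_action_def antiunitary_op_def modular_conj_involution)
qed

end

section \<open>The canonical weight for the trivial subsystem\<close>

definition line :: "'h::complex_inner \<Rightarrow> 'h set"
  where "line y = range (\<lambda>c. c *\<^sub>C y)"

lemma csubspace_line: "csubspace (line y)"
  by (rule complex_vector.subspaceI)
    (auto simp: line_def scaleC_scaleC scaleC_add_left [symmetric] image_iff
      intro: exI [of _ 0] scaleC.zero_left [symmetric])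

lemma mem_line: "y \<in> line y"
  unfolding line_def by (rule range_eqI [of _ _ 1]) simp

lemma line_scaleC:
  assumes "c \<noteq> 0"
  shows "line (c *\<^sub>C y) = line y"
proof -
  have "d *\<^sub>C y \<in> line (c *\<^sub>C y)" for d
    unfolding line_def by (rule range_eqI [of _ _ "d / c"]) (use assms in \<open>simp add: scaleC_scaleC\<close>)
  then show ?thesis by (auto simp: line_def scaleC_scaleC)
qed

lemma closed_line: "closed (line y)"
proof (cases "y = 0")
  case True
  then show ?thesis by (simp add: line_def scaleC.zero_right)
next
  case False
  \<comment> \<open>The line is the fixed-point set of the continuous projection onto it; the
    inverse of \<open>cinner y y\<close> normalizes \<open>y\<close>.\<close>
  have "line y = {x. x = cinner y x *\<^sub>C (inverse (cinner y y)) *\<^sub>C y}"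
    using False
    by (auto simp: line_def cinner_scaleC_right scaleC_scaleC image_iff)
  also have "closed \<dots>"
    by (intro closed_Collect_eq continuous_on_id bounded_clinear_continuous bounded_clinear_rank_one)
  finally show ?thesis .
qed

lemma ortho_complement_line: "x \<in> ortho_complement (line y) \<longleftrightarrow> cinner y x = 0"
  by (auto simp: ortho_complement_def line_def cinner_scaleC_left dest: spec [of _ 1])

lemma ortho_proj_line:
  assumes "norm y = 1"
  shows "ortho_proj (line y) = (\<lambda>x. cinner y x *\<^sub>C y)"
proof
  fix x
  have "cinner y (x - cinner y x *\<^sub>C y) = 0"
    using assms by (simp add: cinner.diff_right cinner_scaleC_right cinner_self)
  then show "ortho_proj (line y) x = cinner y x *\<^sub>C y"
    by (intro ortho_proj_eqI csubspace_line)
      (auto simp: line_def ortho_complement_def cinner_scaleC_left)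
qed

section \<open>Positive operators built from projections\<close>

lemma cinner_rank_one_nonneg: "cinner x (cinner y x *\<^sub>C y) \<in> \<real>\<^sub>\<ge>\<^sub>0"
proof -
  have "cinner x (cinner y x *\<^sub>C y) = cinner y x * cnj (cinner y x)"
    using cinner_commute [of x y] by (simp add: cinner_scaleC_right)
  then show ?thesis
    by (simp add: complex_norm_square [symmetric] nonneg_Reals_of_real_iff del: of_real_power)
qed

lemma positive_op_rank_one: "positive_op (\<lambda>x. cinner y x *\<^sub>C y)"
  by (simp add: positive_op_def bounded_clinear_rank_one cinner_rank_one_nonneg)

lemma positive_op_zero: "positive_op (\<lambda>x. 0)"
  using positive_op_rank_one [of 0] by (simp add: scaleC.zero_right)

lemma positive_op_plus:
  assumes "positive_op S" "positive_op T"
  shows "positive_op (\<lambda>x. S x + T x)"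
  using assms by (simp add: positive_op_def bounded_clinear_plus cinner_add_right nonneg_Reals_add_I)

lemma positive_op_sum_rank_one:
  "finite B \<Longrightarrow> positive_op (\<lambda>x. \<Sum>b\<in>B. cinner b x *\<^sub>C b)"
  by (induction rule: finite_induct)
    (simp_all add: positive_op_zero positive_op_plus positive_op_rank_one)

text \<open>The difference behaves like the projection onto the part of \<open>V\<close> orthogonal
  to \<open>B\<close>: \<open>?R x\<close> is orthogonal to \<open>x - ?R x\<close>, so
  \<open>cinner x (?R x)\<close> is the squared norm of \<open>?R x\<close>. It makes the weight of
  \<open>ortho_proj V\<close> at least that of the finite sum.\<close>

lemma positive_op_ortho_proj_diff:
  fixes V :: "'h::chilbert_space set"
  assumes V: "csubspace V" "closed V" and B: "B \<subseteq> V" "finite B" "orthonormal B"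
  shows "positive_op (\<lambda>x. ortho_proj V x - (\<Sum>b\<in>B. cinner b x *\<^sub>C b))" (is "positive_op ?R")
  unfolding positive_op_def
proof (intro conjI allI)
  show "bounded_clinear ?R"
    using bounded_clinear_ortho_proj [OF V] positive_op_sum_rank_one [OF B(2)]
    by (intro bounded_clinear_minus) (auto simp: positive_op_def)
  fix x
  define s where "s = (\<Sum>b\<in>B. cinner b x *\<^sub>C b)"
  have R: "?R x = ortho_proj V x - s" by (simp add: s_def)
  have "s \<in> V"
    unfolding s_def using B(1)
    by (intro complex_vector.subspace_sum complex_vector.subspace_scale V) auto
  then have "?R x \<in> V" unfolding R by (intro complex_vector.subspace_diff V ortho_proj_in)
  then have "cinner (?R x) (x - ortho_proj V x) = 0"
    using ortho_proj_diff [OF V, of x] unfolding ortho_complement_def by blast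
  moreover have "cinner (?R x) b = 0" if "b \<in> B" for b
  proof -
    have "cinner b (?R x) = cinner b (x - s)"
      using cinner_ortho_proj [OF V, of b x] that B(1) by (auto simp: R cinner.diff_right)
    also have "\<dots> = 0" unfolding s_def by (rule cinner_fourier_diff [OF B(3,2) that])
    finally show ?thesis using cinner_eq_0_commute by blast
  qed
  then have "cinner (?R x) s = 0" by (simp add: s_def cinner.sum_right cinner_scaleC_right)
  ultimately have "cinner (?R x) (x - ?R x) = 0"
    by (simp add: R cinner.diff_right)
  then have "cinner (?R x) x = cinner (?R x) (?R x)" by (simp add: cinner.diff_right)
  then have "cinner x (?R x) = cnj (cinner (?R x) (?R x))"
    using cinner_commute [of x "?R x"] by simp
  then have "cinner x (?R x) = complex_of_real ((norm (?R x))\<^sup>2)"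
    by (simp only: cinner_self complex_cnj_complex_of_real)
  then show "cinner x (?R x) \<in> \<real>\<^sub>\<ge>\<^sub>0"
    by (simp only: nonneg_Reals_of_real_iff zero_le_power2)
qed

locale trivial_subsystem = represented_system A \<Omega>
  for A :: "'h::chilbert_space system_data" and \<Omega> :: 'h +
  fixes F :: "'h system_data" and \<tau> :: "('h \<Rightarrow> 'h) \<Rightarrow> ennreal"
  assumes alg_F: "alg F = scalar_ops" and weight: "canonical_weight A \<Omega> F \<tau>"
begin

lemma sub_space_eq: "sub_space \<Omega> F = line \<Omega>"
proof -
  have "(\<lambda>a. a \<Omega>) ` alg F = line \<Omega>" by (auto simp: alg_F scalar_ops_def line_def image_iff)
  then show ?thesis by (simp add: sub_space_def closure_closed [OF closed_line])
qed

lemma sub_proj_in: "sub_proj \<Omega> F x \<in> line \<Omega>"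
  unfolding sub_proj_def sub_space_eq by (intro ortho_proj_in csubspace_line closed_line)

lemma sub_proj_Omega: "sub_proj \<Omega> F \<Omega> = \<Omega>"
  unfolding sub_proj_def sub_space_eq
  by (rule ortho_proj_eqI) (simp_all add: csubspace_line mem_line ortho_complement_line cinner.zero_right)

text \<open>An operator commuting with \<open>e\<^sub>F\<close> has \<open>\<Omega>\<close> as an eigenvector, so if it also commutes with \<open>A\<close>
  it is scalar on the dense subspace \<open>A\<Omega>\<close>.  Hence the basic construction is everything.\<close>

lemma basic_construction_everything:
  assumes T: "bounded_clinear T"
  shows "T \<in> basic_construction A \<Omega> F"
  unfolding basic_construction_def hull_def
proof (intro InterI)
  \<comment> \<open>The hull is an intersection, so \<open>T\<close> is placed in each competing
    algebra \<open>N\<close> by means of its bicommutant.\<close>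
  fix N assume "N \<in> {N. von_neumann_algebra N \<and> insert (sub_proj \<Omega> F) (alg A) \<subseteq> N}"
  then have N: "commutant (commutant N) = N" "sub_proj \<Omega> F \<in> N" "alg A \<subseteq> N"
    by (auto simp: von_neumann_algebra_def)
  have "T \<circ> S = S \<circ> T" if "S \<in> commutant N" for S
  proof -
    have S: "bounded_clinear S" "\<And>R. R \<in> N \<Longrightarrow> S \<circ> R = R \<circ> S"
      using that by (auto simp: commutant_def)
    have "S \<Omega> = sub_proj \<Omega> F (S \<Omega>)"
      using fun_cong [OF S(2) [OF N(2)], of \<Omega>] by (simp add: sub_proj_Omega)
    then have "S \<Omega> \<in> line \<Omega>" using sub_proj_in by metis
    then obtain c where c: "S \<Omega> = c *\<^sub>C \<Omega>" by (auto simp: line_def)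
    have "S (a \<Omega>) = c *\<^sub>C a \<Omega>" if "a \<in> alg A" for a
    proof -
      have "S (a \<Omega>) = a (S \<Omega>)" using fun_cong [OF S(2), of a \<Omega>] that N(3) by auto
      then show ?thesis by (simp add: c bounded_clinear_scaleC alg_bounded_clinear that)
    qed
    moreover have "closed {x. S x = c *\<^sub>C x}"
      by (intro closed_Collect_eq bounded_clinear_continuous S(1) bounded_clinear_scaled)
    ultimately have "closure ((\<lambda>a. a \<Omega>) ` alg A) \<subseteq> {x. S x = c *\<^sub>C x}"
      by (intro closure_minimal) auto
    then have "S x = c *\<^sub>C x" for x using alg_dense by auto
    then show ?thesis by (simp add: fun_eq_iff bounded_clinear_scaleC [OF T])
  qed
  then have "T \<in> commutant (commutant N)" using T by (simp add: commutant_def [of "commutant N"])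
  then show "T \<in> N" by (simp add: N)
qed

lemma positive_part_basic_construction:
  "positive_op T \<Longrightarrow> T \<in> positive_part (basic_construction A \<Omega> F)"
  by (simp add: positive_part_def basic_construction_everything positive_op_def)

lemma weight_add:
  assumes "positive_op S" "positive_op T"
  shows "\<tau> (\<lambda>x. S x + T x) = \<tau> S + \<tau> T"
  using weight assms positive_part_basic_construction
  by (simp add: canonical_weight_def fns_tracial_weight_def)

lemma weight_zero: "\<tau> (\<lambda>x. 0) = 0"
proof -
  have "\<forall>r\<ge>0. \<forall>a\<in>positive_part (basic_construction A \<Omega> F).
      \<tau> (\<lambda>x. r *\<^sub>R a x) = ennreal r * \<tau> a"
    using weight unfolding canonical_weight_def fns_tracial_weight_def by blast
  \<comment> \<open>Homogeneity with factor 0 suffices even before the value is known to be finite,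
    since 0 times infinity is 0 in \<open>ennreal\<close>.\<close>
  from this [rule_format, of 0 "\<lambda>x. 0"] show ?thesis
    using positive_part_basic_construction [OF positive_op_zero] by simp
qed

lemma weight_faithful: "positive_op T \<Longrightarrow> \<tau> T = 0 \<Longrightarrow> T = (\<lambda>x. 0)"
  using weight positive_part_basic_construction
  by (simp add: canonical_weight_def fns_tracial_weight_def)

text \<open>The rank-one operator \<open>u\<close> with \<open>u y = z\<close> satisfies \<open>u\<^sup>* u = P\<^sub>y\<close> and \<open>u u\<^sup>* = P\<^sub>z\<close>.\<close>

lemma weight_rank_one_eq:
  assumes "norm y = 1" "norm z = 1"
  shows "\<tau> (\<lambda>x. cinner y x *\<^sub>C y) = \<tau> (\<lambda>x. cinner z x *\<^sub>C z)"
proof -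
  define u where "u = (\<lambda>x. cinner y x *\<^sub>C z)"
  have "cadjoint u = (\<lambda>x. cinner z x *\<^sub>C y)"
    by (rule cadjoint_eqI)
      (simp add: u_def cinner_scaleC_left cinner_scaleC_right cinner_commute [of _ z] mult.commute)
  then have "cadjoint u \<circ> u = (\<lambda>x. cinner y x *\<^sub>C y)" "u \<circ> cadjoint u = (\<lambda>x. cinner z x *\<^sub>C z)"
    using assms by (auto simp: u_def cinner_scaleC_right cinner_self)
  moreover have "\<tau> (cadjoint u \<circ> u) = \<tau> (u \<circ> cadjoint u)"
    using weight basic_construction_everything [of u]
    by (simp add: canonical_weight_def fns_tracial_weight_def u_def bounded_clinear_rank_one)
  ultimately show ?thesis by simp
qed

lemma weight_sub_proj_finite: "\<tau> (sub_proj \<Omega> F) < \<infinity>"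
proof -
  have "positive_op (sub_proj \<Omega> F)"
    unfolding sub_proj_def sub_space_eq
    \<comment> \<open>With the empty orthonormal set the difference is the projection
      itself.\<close>
    using positive_op_ortho_proj_diff [OF csubspace_line closed_line, of "{}" \<Omega>]
    by (simp add: orthonormal_def)
  moreover have "\<forall>(n::nat) a b. (\<forall>i<n. a i \<in> alg A \<and> b i \<in> alg A) \<longrightarrow>
      positive_op (\<lambda>x. \<Sum>i<n. a i (sub_proj \<Omega> F (b i x))) \<longrightarrow>
      \<tau> (\<lambda>x. \<Sum>i<n. a i (sub_proj \<Omega> F (b i x))) < \<infinity>"
    using weight unfolding canonical_weight_def Let_def by blast
  \<comment> \<open>A single summand with both factors \<open>id\<close> turns the sum into
    \<open>sub_proj \<Omega> F\<close>.\<close>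
  from this [rule_format, of 1 "\<lambda>_. id" "\<lambda>_. id"]
  have "positive_op (sub_proj \<Omega> F) \<Longrightarrow> \<tau> (sub_proj \<Omega> F) < \<infinity>"
    using alg_id by simp
  ultimately show ?thesis by blast
qed

text \<open>The comparison is with the normalization of \<Omega>, whose rank-one projection is
  \<open>sub_proj \<Omega> F\<close>.\<close>

lemma weight_rank_one_finite:
  assumes "norm y = 1"
  shows "\<tau> (\<lambda>x. cinner y x *\<^sub>C y) < \<infinity>"
proof -
  have "y \<noteq> 0" using assms by auto
  then have "\<Omega> \<noteq> 0" by (rule Omega_nonzero)
  define \<omega> where "\<omega> = complex_of_real (inverse (norm \<Omega>)) *\<^sub>C \<Omega>"
  have "norm \<omega> = 1" "line \<omega> = line \<Omega>"
    using \<open>\<Omega> \<noteq> 0\<close> by (simp_all add: \<omega>_def norm_scaleC norm_inverse line_scaleC)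
  then have "\<tau> (\<lambda>x. cinner y x *\<^sub>C y) = \<tau> (sub_proj \<Omega> F)"
    using weight_rank_one_eq [OF assms, of \<omega>] ortho_proj_line [of \<omega>]
    by (simp add: sub_proj_def sub_space_eq)
  then show ?thesis using weight_sub_proj_finite by simp
qed

lemma weight_orthonormal_sum:
  assumes "norm e = 1" "finite B" "orthonormal B"
  shows "\<tau> (\<lambda>x. \<Sum>b\<in>B. cinner b x *\<^sub>C b) = of_nat (card B) * \<tau> (\<lambda>x. cinner e x *\<^sub>C e)"
  using assms(2,3)
proof (induction rule: finite_induct)
  case empty
  then show ?case by (simp add: weight_zero)
next
  case (insert b B)
  have "cinner b b = 1" using insert.prems by (simp add: orthonormal_def)
  then have "(norm b)\<^sup>2 = 1" by (simp only: cinner_self of_real_eq_1_iff)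
  then have "norm b = 1" using norm_ge_zero [of b] by (simp only: power2_eq_1_iff) linarith
  have "\<tau> (\<lambda>x. \<Sum>b\<in>insert b B. cinner b x *\<^sub>C b)
    = \<tau> (\<lambda>x. cinner b x *\<^sub>C b) + \<tau> (\<lambda>x. \<Sum>b\<in>B. cinner b x *\<^sub>C b)"
    using insert.hyps weight_add [OF positive_op_rank_one positive_op_sum_rank_one] by simp
  also have "\<dots> = \<tau> (\<lambda>x. cinner e x *\<^sub>C e) + of_nat (card B) * \<tau> (\<lambda>x. cinner e x *\<^sub>C e)"
    using insert weight_rank_one_eq [OF \<open>norm b = 1\<close> assms(1)] by (simp add: orthonormal_def)
  finally show ?case using insert.hyps by (simp add: distrib_right)
qed

lemma finite_weight_finite_dimensional:
  assumes V: "csubspace V" "closed V" and "\<tau> (ortho_proj V) < \<infinity>"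
  shows "\<exists>B. finite B \<and> V \<subseteq> cspan B"
proof (cases "V \<subseteq> {0}")
  case True
  then have "V \<subseteq> cspan {0}" by (rule order_trans [OF _ complex_vector.span_superset])
  then show ?thesis by (intro exI [of _ "{0}"]) simp
next
  case False
  then obtain x where "x \<noteq> 0" "x \<in> V" by auto
  define e where "e = complex_of_real (inverse (norm x)) *\<^sub>C x"
  have e: "norm e = 1" using \<open>x \<noteq> 0\<close> by (simp add: e_def norm_scaleC norm_inverse)
  define k where "k = \<tau> (\<lambda>x. cinner e x *\<^sub>C e)"
  have "k \<noteq> 0"
  proof
    assume "k = 0"
    then have "(\<lambda>x. cinner e x *\<^sub>C e) = (\<lambda>x. 0)"
      unfolding k_def by (rule weight_faithful [OF positive_op_rank_one])
    then have "cinner e e *\<^sub>C e = 0" by (rule fun_cong)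
    with e show False by (simp add: cinner_self)
  qed
  have le: "of_nat (card B) * k \<le> \<tau> (ortho_proj V)" if "B \<subseteq> V" "finite B" "orthonormal B" for B
  proof -
    let ?S = "\<lambda>x. \<Sum>b\<in>B. cinner b x *\<^sub>C b"
    \<comment> \<open>Splitting the projection into two positive operators lets additivity serve as
      monotonicity.\<close>
    have "\<tau> (\<lambda>x. ?S x + (ortho_proj V x - ?S x)) = \<tau> ?S + \<tau> (\<lambda>x. ortho_proj V x - ?S x)"
      using that V by (intro weight_add positive_op_sum_rank_one positive_op_ortho_proj_diff)
    then have "\<tau> (ortho_proj V) = \<tau> ?S + \<tau> (\<lambda>x. ortho_proj V x - ?S x)"
      by simp
    then show ?thesis using weight_orthonormal_sum [OF e] that by (simp add: k_def)
  qed
  \<comment> \<open>The dimension bound uses just a positive real lower bound of \<open>k\<close>;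
    should \<open>k\<close> be infinite, 1 serves.\<close>
  obtain r where r: "r > 0" "ennreal r \<le> k"
  proof (cases k)
    case (real r)
    with \<open>k \<noteq> 0\<close> show thesis by (intro that [of r]) (auto simp: less_le)
  next
    case top
    then show thesis by (intro that [of 1]) auto
  qed
  obtain t where t: "\<tau> (ortho_proj V) = ennreal t" "t \<ge> 0"
    using assms(3) by (cases "\<tau> (ortho_proj V)") auto
  have "card B \<le> nat \<lceil>t / r\<rceil>" if "B \<subseteq> V" "finite B" "orthonormal B" for B
  proof -
    have "ennreal (real (card B) * r) = of_nat (card B) * ennreal r"
      using r(1) by (simp add: ennreal_mult ennreal_of_nat_eq_real_of_nat)
    also have "\<dots> \<le> of_nat (card B) * k" by (intro mult_left_mono r) simp
    also have "\<dots> \<le> ennreal t" using le [OF that] t by simp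
    finally have "real (card B) * r \<le> t" using t(2) by (simp add: ennreal_le_iff)
    then have "real (card B) \<le> t / r" using r(1) by (simp add: field_simps)
    then show ?thesis by linarith
  qed
  then show ?thesis by (rule finite_dimensional_if_orthonormal_bounded [OF V(1)])
qed

lemma U_weight_module_line:
  assumes y: "y \<noteq> 0" "evolution A \<Omega> y = c *\<^sub>C y" "cinner \<Omega> y = 0"
  shows "U_weight_module A \<Omega> F \<tau> (line y)"
  unfolding U_weight_module_def right_submodule_def sub_space_eq
proof (intro conjI ballI csubspace_line closed_line)
  show "right_action A \<Omega> x a \<in> line y" if "x \<in> line y" "a \<in> alg F" for x a
    using that complex_vector.subspace_scale [OF csubspace_line]
    by (auto simp: alg_F scalar_ops_def right_action_scalar)
  have "bounded_clinear (evolution A \<Omega>)" using evolution_unitary by (simp add: unitary_op_def)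
  then have "evolution A \<Omega> ` line y = line (c *\<^sub>C y)"
    by (auto simp: line_def image_image bounded_clinear_scaleC y)
  moreover have "c \<noteq> 0" using cinner_eigenvector_unitary(2) [OF evolution_unitary y(1,2)] by auto
  ultimately show "evolution A \<Omega> ` line y = line y" by (simp add: line_scaleC)
  show "line y \<subseteq> ortho_complement (line \<Omega>)"
    using y(3) by (auto simp: ortho_complement_line line_def [of y] cinner_scaleC_right)
  define e where "e = complex_of_real (inverse (norm y)) *\<^sub>C y"
  have "norm e = 1" "line e = line y"
    using y(1) by (simp_all add: e_def norm_scaleC norm_inverse line_scaleC)
  then show "\<tau> (ortho_proj (line y)) < \<infinity>"
    using ortho_proj_line [of e] weight_rank_one_finite [of e] by simp
qed

section \<open>The two implications\<close>

abbreviation eigenvectors :: "'h set"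
  where "eigenvectors \<equiv> {x. x \<noteq> 0 \<and> (\<exists>c. evolution A \<Omega> x = c *\<^sub>C x)}"

lemma module_span_subset: "module_span A \<Omega> F \<tau> \<subseteq> ortho_complement (line \<Omega>)"
  unfolding module_span_def
proof (rule closure_cspan_minimal [OF _ csubspace_ortho_complement closed_ortho_complement])
  show "\<Union> {V. U_weight_module A \<Omega> F \<tau> V} \<subseteq> ortho_complement (line \<Omega>)"
    unfolding U_weight_module_def sub_space_eq by blast
qed

lemma module_span_subset_eigenvectors:
  "module_span A \<Omega> F \<tau> \<subseteq> closure (cspan eigenvectors)"
  unfolding module_span_def
proof (rule closure_cspan_minimal)
  show "csubspace (closure (cspan eigenvectors))"
    by (intro csubspace_closure complex_vector.subspace_span)
  show "\<Union> {V. U_weight_module A \<Omega> F \<tau> V} \<subseteq> closure (cspan eigenvectors)"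
  proof (intro Union_least)
    fix V assume "V \<in> {V. U_weight_module A \<Omega> F \<tau> V}"
    then have V: "csubspace V" "closed V" "evolution A \<Omega> ` V \<subseteq> V" "\<tau> (ortho_proj V) < \<infinity>"
      by (auto simp: U_weight_module_def right_submodule_def)
    obtain B where "finite B" "V \<subseteq> cspan B"
      using finite_weight_finite_dimensional [OF V(1,2,4)] by blast
    then show "V \<subseteq> closure (cspan eigenvectors)"
      by (rule finite_dimensional_eigenvectors_dense [OF evolution_unitary V(1-3)])
  qed
qed (rule closed_closure)

lemma discrete_spectrum_if_relative:
  assumes "rel_discrete_spectrum A \<Omega> F \<tau>"
  shows "discrete_spectrum A \<Omega>"
proof -
  let ?E = "closure (cspan eigenvectors)"
  have E: "csubspace ?E" by (intro csubspace_closure complex_vector.subspace_span)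
  have "\<Omega> \<in> ?E"
  \<comment> \<open>Eigenvectors are nonzero by definition, so the zero space, where \<Omega>
    vanishes, is treated apart.\<close>
  proof (cases "\<Omega> = 0")
    case True
    then show ?thesis using complex_vector.subspace_0 [OF E] by simp
  next
    case False
    then have "\<Omega> \<in> eigenvectors" using evolution_Omega by (auto intro: exI [of _ 1])
    then show ?thesis by (rule subsetD [OF closure_cspan_superset])
  qed
  have "x \<in> ?E" for x
  proof -
    obtain d where d: "sub_proj \<Omega> F x = d *\<^sub>C \<Omega>" using sub_proj_in by (auto simp: line_def)
    have "x - d *\<^sub>C \<Omega> \<in> ortho_complement (line \<Omega>)"
      using ortho_proj_diff [OF csubspace_line closed_line, of x \<Omega>] d
      by (simp add: sub_proj_def sub_space_eq)
    also have "\<dots> \<subseteq> ?E"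
      using assms module_span_subset_eigenvectors by (simp add: rel_discrete_spectrum_def sub_space_eq)
    finally have "d *\<^sub>C \<Omega> + (x - d *\<^sub>C \<Omega>) \<in> ?E"
      using \<open>\<Omega> \<in> ?E\<close> E by (intro complex_vector.subspace_add complex_vector.subspace_scale)
    then show ?thesis by simp
  qed
  then show ?thesis unfolding discrete_spectrum_def by blast
qed

text \<open>Eigenvectors of the evolution need not be orthogonal to \<Omega>, so they are first sent
  through the projection \<open>Q\<close> onto the complement of \<Omega>. The vectors that
  \<open>Q\<close> maps into the module span form a closed subspace, so checking eigenvectors is
  enough.\<close>

lemma relative_if_discrete_spectrum:
  assumes "discrete_spectrum A \<Omega>"
  shows "rel_discrete_spectrum A \<Omega> F \<tau>"
proof -
  let ?M = "module_span A \<Omega> F \<tau>" and ?U = "evolution A \<Omega>"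
  have M: "csubspace ?M" "closed ?M"
    by (simp_all add: module_span_def csubspace_closure)
  \<comment> \<open>The case \<open>y = 0\<close> is included because \<open>Q\<close> may
    annihilate an eigenvector, for instance a nonzero \<Omega>.\<close>
  have M_line: "y \<in> ?M" if "?U y = c *\<^sub>C y" "cinner \<Omega> y = 0" for y c
  proof (cases "y = 0")
    case True
    then show ?thesis using complex_vector.subspace_0 [OF M(1)] by simp
  next
    case False
    then have "y \<in> \<Union> {V. U_weight_module A \<Omega> F \<tau> V}"
      using U_weight_module_line [OF False that] mem_line by blast
    then show ?thesis unfolding module_span_def by (rule subsetD [OF closure_cspan_superset])
  qed
  define Q where "Q = (\<lambda>x. x - sub_proj \<Omega> F x)"
  have "bounded_clinear (sub_proj \<Omega> F)"
    unfolding sub_proj_def sub_space_eq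
    by (intro bounded_clinear_ortho_proj csubspace_line closed_line)
  moreover have "bounded_clinear (\<lambda>x::'h. x)" using bounded_clinear_scaled [of 1] by simp
  ultimately have Q: "bounded_clinear Q" unfolding Q_def by (rule bounded_clinear_minus [rotated])
  have Q_ortho: "cinner \<Omega> (Q x) = 0" for x
    using ortho_proj_diff [OF csubspace_line closed_line, of x \<Omega>]
    by (simp add: Q_def sub_proj_def sub_space_eq ortho_complement_line)
  have Q_id: "Q x = x" if "cinner \<Omega> x = 0" for x
  proof -
    have "sub_proj \<Omega> F x = 0"
      unfolding sub_proj_def sub_space_eq using that
      by (intro ortho_proj_eqI csubspace_line complex_vector.subspace_0) (simp add: ortho_complement_line)
    then show ?thesis by (simp add: Q_def)
  qed
  have U: "bounded_clinear ?U" "bounded_linear ?U"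
    using evolution_unitary by (auto simp: unitary_op_def bounded_clinear_def)
  have "eigenvectors \<subseteq> {x. Q x \<in> ?M}"
  proof
    fix x assume "x \<in> eigenvectors"
    then obtain c where x: "x \<noteq> 0" "?U x = c *\<^sub>C x" by blast
    have "cinner \<Omega> x = c * cinner \<Omega> x"
    proof -
      have "cinner \<Omega> x = cinner (?U \<Omega>) (?U x)"
        using evolution_unitary unfolding unitary_op_def by metis
      then show ?thesis using x by (simp add: evolution_Omega cinner_scaleC_right)
    qed
    \<comment> \<open>In the first case \<open>Q\<close> fixes \<open>x\<close>; in the second,
      \<open>Q x\<close> is a difference of vectors fixed by the evolution. Either way it keeps the
      eigenvalue.\<close>
    then consider "cinner \<Omega> x = 0" | "c = 1" by auto
    then have "?U (Q x) = c *\<^sub>C Q x"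
    proof cases
      case 1
      then show ?thesis using x by (simp add: Q_id)
    next
      case 2
      obtain d where "sub_proj \<Omega> F x = d *\<^sub>C \<Omega>" using sub_proj_in by (auto simp: line_def)
      then show ?thesis
        using 2 x by (simp add: Q_def linear_simps [OF U(2)] bounded_clinear_scaleC [OF U(1)] evolution_Omega)
    qed
    then show "x \<in> {x. Q x \<in> ?M}" using M_line Q_ortho by blast
  qed
  moreover have "csubspace {x. Q x \<in> ?M}"
    using M(1) complex_vector.subspace_0 complex_vector.subspace_add complex_vector.subspace_scale
    by (intro complex_vector.subspaceI)
      (auto simp: bounded_clinear_zero [OF Q] bounded_clinear_add [OF Q] bounded_clinear_scaleC [OF Q])
  moreover have "closed {x. Q x \<in> ?M}"
    using closed_vimage [OF M(2) bounded_clinear_continuous [OF Q]] by (simp add: vimage_def)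
  ultimately have "closure (cspan eigenvectors) \<subseteq> {x. Q x \<in> ?M}" by (rule closure_cspan_minimal)
  then have "Q x \<in> ?M" for x using assms by (auto simp: discrete_spectrum_def)
  then have "ortho_complement (line \<Omega>) \<subseteq> ?M"
    using Q_id by (metis ortho_complement_line subsetI)
  then show ?thesis
    unfolding rel_discrete_spectrum_def sub_space_eq using module_span_subset by blast
qed

end

theorem proposition3p10:
  fixes A F :: "'h::chilbert_space system_data"
    and \<Omega> :: 'h
    and \<tau> :: "('h \<Rightarrow> 'h) \<Rightarrow> ennreal"
  assumes "system A"
    and "represented_by A \<Omega>"
    and "subsystem F A"
    and "alg F = scalar_ops"
    and "canonical_weight A \<Omega> F \<tau>"
  shows "rel_discrete_spectrum A \<Omega> F \<tau> \<longleftrightarrow> discrete_spectrum A \<Omega>"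
proof -
  interpret trivial_subsystem A \<Omega> F \<tau>
    by unfold_locales (use assms in auto)
  show ?thesis using discrete_spectrum_if_relative relative_if_discrete_spectrum by blast
qed

end
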